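(* Let $\mathbb{K}$ be a field of characteristic zero and let $\mathcal{D}\subset\mathbb{Z}_+^3$ be a three-dimensional Ferrers diagram which satisfies the projection property. Then the simplicial complex $\Delta(\mathcal{D})$ is pure vertex-decomposable of dimension $a_{\mathcal{D}}+b_{\mathcal{D}}+c_{\mathcal{D}}-3$.
   Context: $\mathbb{Z}_+$ denotes the positive integers. A three-dimensional Ferrers diagram is a finite nonempty set $\mathcal{D}\subset\mathbb{Z}_+^3$ such that whenever $(i_0,j_0,k_0)\in\mathcal{D}$ and $i\le i_0$, $j\le j_0$, $k\le k_0$ are positive integers, then $(i,j,k)\in\mathcal{D}$. Let $a_{\mathcal{D}},b_{\mathcal{D}},c_{\mathcal{D}}$ be the numbers of distinct first, second, third coordinates of points of $\mathcal{D}$. $\mathcal{D}$ satisfies the projection property if for every $2\le i\le a_{\mathcal{D}}$ one has $(i-1,b_i,c_i)\in\mathcal{D}$, where $b_i=\max\{j:(i,j,1)\in\mathcal{D}\}$ and $c_i=\max\{k:(i,1,k)\in\mathcal{D}\}$. Let $\mathbb{K}[\mathbf{T}_{\mathcal{D}}]=\mathbb{K}[T_{\boldsymbol u}:\boldsymbol u\in\mathcal{D}]$. For $\boldsymbol u=(i_1,j_1,k_1)$, $\boldsymbol v=(i_2,j_2,k_2)$ in $\mathcal{D}$ put $\mathbf{I}_{2,x}(\boldsymbol u,\boldsymbol v)=T_{\boldsymbol u}T_{\boldsymbol v}-T_{i_2,j_1,k_1}T_{i_1,j_2,k_2}$ if both $(i_2,j_1,k_1),(i_1,j_2,k_2)\in\mathcal{D}$,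 and $0$ otherwise; $\mathbf{I}_{2,y}$ and $\mathbf{I}_{2,z}$ are defined analogously by switching the second, respectively third, coordinates. The 2-minors ideal $\mathbf{I}_2(\mathcal{D})\subset\mathbb{K}[\mathbf{T}_{\mathcal{D}}]$ is generated by all $\mathbf{I}_{2,x}(\boldsymbol u,\boldsymbol v),\mathbf{I}_{2,y}(\boldsymbol u,\boldsymbol v),\mathbf{I}_{2,z}(\boldsymbol u,\boldsymbol v)$ with $\boldsymbol u,\boldsymbol v\in\mathcal{D}$. Initial ideals $\mathrm{in}(\cdot)$ are with respect to the lexicographic monomial order induced by $T_{i,j,k}>T_{i',j',k'}$ iff $(i,j,k)$ precedes $(i',j',k')$ lexicographically (so $T_{1,1,1}$ is the largest variable). Define $$\Delta(\mathcal{D})=\Big\{F\subseteq\{T_{\boldsymbol u}:\boldsymbol u\in\mathcal{D}\}:\prod_{T_{\boldsymbol v}\in F}T_{\boldsymbol v}\notin\mathrm{in}(\mathbf{I}_2(\mathcal{D}))\Big\}.$$ A pure simplicial complex $\Delta$ is vertex-decomposable if $\Delta$ is a simplex or $\{\varnothing\}$, or there is a vertex $v$ such that the link $\mathrm{link}_\Delta(v)$ and the deletion $\Delta\setminus v$ are both pure and vertex-decomposable and $\dim\Delta=\dim(\Delta\setminus v)=\dim(\mathrm{link}_\Delta(v))+1$. *)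

theory Defs
  imports
    "HOL-Library.Poly_Mapping"
    "HOL-Library.Product_Lexorder"
    "HOL-Algebra.Ideal"
begin

section \<open>Three-dimensional Ferrers diagrams\<close>

type_synonym point = "nat \<times> nat \<times> nat"

definition ferrers_diagram :: "point set \<Rightarrow> bool" where
  "ferrers_diagram D \<longleftrightarrow>
     finite D \<and> D \<noteq> {} \<and>
     (\<forall>(i, j, k) \<in> D. 1 \<le> i \<and> 1 \<le> j \<and> 1 \<le> k) \<and>
     (\<forall>(i0, j0, k0) \<in> D. \<forall>i j k.
        1 \<le> i \<and> i \<le> i0 \<and> 1 \<le> j \<and> j \<le> j0 \<and> 1 \<le> k \<and> k \<le> k0 \<longrightarrow> (i, j, k) \<in> D)"

definition num_x :: "point set \<Rightarrow> nat" where
  "num_x D = card ((\<lambda>(i, j, k). i) ` D)"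

definition num_y :: "point set \<Rightarrow> nat" where
  "num_y D = card ((\<lambda>(i, j, k). j) ` D)"

definition num_z :: "point set \<Rightarrow> nat" where
  "num_z D = card ((\<lambda>(i, j, k). k) ` D)"

text \<open>For a Ferrers diagram and \<open>1 \<le> i \<le> num_x D\<close> the point \<open>(i, 1, 1)\<close> lies in \<open>D\<close>, so
  both maxima below are taken over finite nonempty sets.\<close>

definition projection_property :: "point set \<Rightarrow> bool" where
  "projection_property D \<longleftrightarrow>
     (\<forall>i. 2 \<le> i \<and> i \<le> num_x D \<longrightarrow>
        (i - 1, Max {j. (i, j, 1) \<in> D}, Max {k. (i, 1, k) \<in> D}) \<in> D)"


section \<open>The polynomial ring of a set of points\<close>

text \<open>A monomial is its exponent vector. The order on monomials is the one that
  \<^theory>\<open>HOL-Library.Poly_Mapping\<close> puts on finitely supported functions: \<open>m < n\<close> iff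
  \<open>m u < n u\<close> at the least point \<open>u\<close> where they differ. As points are ordered lexicographically
  (\<^theory>\<open>HOL-Library.Product_Lexorder\<close>), this is the lexicographic monomial order in which
  \<open>T u\<close> is larger than \<open>T v\<close> iff \<open>u\<close> precedes \<open>v\<close>.\<close>

type_synonym monomial = "point \<Rightarrow>\<^sub>0 nat"
type_synonym 'k tpoly = "monomial \<Rightarrow>\<^sub>0 'k"

definition T :: "point \<Rightarrow> 'k::comm_ring_1 tpoly" where
  "T u = Poly_Mapping.single (Poly_Mapping.single u 1) 1"

text \<open>The type \<^typ>\<open>'k tpoly\<close> has a variable for every point; the ring of interest is the
  subring of polynomials involving only variables from \<open>D\<close>.\<close>

definition poly_ring :: "point set \<Rightarrow> 'k::comm_ring_1 tpoly ring" where
  "poly_ring D =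
     \<lparr>carrier = {p. \<forall>m \<in> Poly_Mapping.keys p. Poly_Mapping.keys m \<subseteq> D},
      mult = (*), one = 1, zero = 0, add = (+)\<rparr>"

definition lead_monomial :: "'k::zero tpoly \<Rightarrow> monomial" where
  "lead_monomial f = Max (Poly_Mapping.keys f)"

definition initial_ideal :: "point set \<Rightarrow> 'k::comm_ring_1 tpoly set \<Rightarrow> 'k tpoly set" where
  "initial_ideal D I =
     Idl\<^bsub>poly_ring D\<^esub> {Poly_Mapping.single (lead_monomial f) 1 | f. f \<in> I \<and> f \<noteq> 0}"


section \<open>The 2-minors ideal and its initial complex\<close>

fun minor_x :: "point set \<Rightarrow> point \<Rightarrow> point \<Rightarrow> 'k::comm_ring_1 tpoly" where
  "minor_x D (i1, j1, k1) (i2, j2, k2) =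
     (if (i2, j1, k1) \<in> D \<and> (i1, j2, k2) \<in> D
      then T (i1, j1, k1) * T (i2, j2, k2) - T (i2, j1, k1) * T (i1, j2, k2) else 0)"

fun minor_y :: "point set \<Rightarrow> point \<Rightarrow> point \<Rightarrow> 'k::comm_ring_1 tpoly" where
  "minor_y D (i1, j1, k1) (i2, j2, k2) =
     (if (i1, j2, k1) \<in> D \<and> (i2, j1, k2) \<in> D
      then T (i1, j1, k1) * T (i2, j2, k2) - T (i1, j2, k1) * T (i2, j1, k2) else 0)"

fun minor_z :: "point set \<Rightarrow> point \<Rightarrow> point \<Rightarrow> 'k::comm_ring_1 tpoly" where
  "minor_z D (i1, j1, k1) (i2, j2, k2) =
     (if (i1, j1, k2) \<in> D \<and> (i2, j2, k1) \<in> D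
      then T (i1, j1, k1) * T (i2, j2, k2) - T (i1, j1, k2) * T (i2, j2, k1) else 0)"

definition minors_ideal :: "point set \<Rightarrow> 'k::comm_ring_1 tpoly set" where
  "minors_ideal D =
     Idl\<^bsub>poly_ring D\<^esub> (\<Union>u \<in> D. \<Union>v \<in> D. {minor_x D u v, minor_y D u v, minor_z D u v})"

text \<open>The vertices are the variables themselves, so the coefficient ring is part of the type.\<close>

definition Delta :: "point set \<Rightarrow> 'k::comm_ring_1 tpoly set set" where
  "Delta D = {F. F \<subseteq> T ` D \<and> (\<Prod>t\<in>F. t) \<notin> initial_ideal D (minors_ideal D)}"


section \<open>Simplicial complexes\<close>

text \<open>The void complex (no faces at all) is excluded, so \<open>{}\<close> is always a face. Elements of an
  ambient vertex set that are not faces (loops) play no role.\<close>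

definition simplicial_complex :: "'v set set \<Rightarrow> bool" where
  "simplicial_complex X \<longleftrightarrow>
     X \<noteq> {} \<and> finite (\<Union>X) \<and> (\<forall>F \<in> X. \<forall>G. G \<subseteq> F \<longrightarrow> G \<in> X)"

definition facets :: "'v set set \<Rightarrow> 'v set set" where
  "facets X = {F \<in> X. \<forall>G \<in> X. F \<subseteq> G \<longrightarrow> F = G}"

text \<open>Integer-valued, because the dimension of \<open>{{}}\<close> is \<open>-1\<close>.\<close>

definition complex_dim :: "'v set set \<Rightarrow> int" where
  "complex_dim X = Max ((\<lambda>F. int (card F) - 1) ` X)"

definition pure_complex :: "'v set set \<Rightarrow> bool" where
  "pure_complex X \<longleftrightarrow>
     simplicial_complex X \<and> (\<forall>F \<in> facets X. \<forall>G \<in> facets X. card F = card G)"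

definition link :: "'v set set \<Rightarrow> 'v \<Rightarrow> 'v set set" where
  "link X v = {F. v \<notin> F \<and> insert v F \<in> X}"

definition deletion :: "'v set set \<Rightarrow> 'v \<Rightarrow> 'v set set" where
  "deletion X v = {F \<in> X. v \<notin> F}"

inductive vertex_decomposable :: "'v set set \<Rightarrow> bool" where
  empty_face: "vertex_decomposable {{}}"
| simplex: "finite V \<Longrightarrow> V \<noteq> {} \<Longrightarrow> vertex_decomposable (Pow V)"
| shedding:
    "\<lbrakk>pure_complex X; {v} \<in> X;
      pure_complex (link X v); vertex_decomposable (link X v);
      pure_complex (deletion X v); vertex_decomposable (deletion X v);
      complex_dim X = complex_dim (deletion X v);
      complex_dim X = complex_dim (link X v) + 1\<rbrakk>
     \<Longrightarrow> vertex_decomposable X"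


section \<open>Sanity checks\<close>

lemma variable_order:
  "(Poly_Mapping.single v 1 :: monomial) < Poly_Mapping.single u 1 \<longleftrightarrow> u < v"
proof
  assume "(Poly_Mapping.single v 1 :: monomial) < Poly_Mapping.single u 1"
  then obtain k where k: "((1::nat) when v = k) < (1 when u = k)"
      and less: "\<forall>k'<k. ((1::nat) when v = k') = (1 when u = k')"
    unfolding less_poly_mapping.rep_eq less_fun_def lookup_single by blast
  from k have "u = k" "v \<noteq> k"
    by (cases "u = k"; cases "v = k"; simp)+
  moreover have "\<not> v < k"
  proof
    assume "v < k"
    with less have "((1::nat) when v = v) = (1 when u = v)" by blast
    with \<open>u = k\<close> \<open>v \<noteq> k\<close> show False by simp
  qed
  ultimately show "u < v" by simp
next
  assume "u < v"
  then show "(Poly_Mapping.single v 1 :: monomial) < Poly_Mapping.single u 1"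
    unfolding less_poly_mapping.rep_eq less_fun_def lookup_single
    by (intro exI[of _ u]) (auto simp: when_def)
qed

lemma cring_poly_ring: "cring (poly_ring D :: 'k::comm_ring_1 tpoly ring)"
proof (intro cringI abelian_groupI comm_monoidI)
  fix p q :: "'k tpoly"
  assume p: "p \<in> carrier (poly_ring D)" and q: "q \<in> carrier (poly_ring D)"
  have "Poly_Mapping.keys m \<subseteq> D" if "m \<in> Poly_Mapping.keys (p + q)" for m
    using that p q Poly_Mapping.keys_add[of p q] unfolding poly_ring_def by auto
  then show "p \<oplus>\<^bsub>poly_ring D\<^esub> q \<in> carrier (poly_ring D)"
    by (simp add: poly_ring_def)
  have "Poly_Mapping.keys m \<subseteq> D" if m: "m \<in> Poly_Mapping.keys (p * q)" for m
  proof -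
    obtain a b where "m = a + b" and a: "a \<in> Poly_Mapping.keys p" and b: "b \<in> Poly_Mapping.keys q"
      using m Poly_Mapping.keys_mult[of p q] by blast
    then have "Poly_Mapping.keys m \<subseteq> Poly_Mapping.keys a \<union> Poly_Mapping.keys b"
      using Poly_Mapping.keys_add[of a b] by simp
    moreover have "Poly_Mapping.keys a \<subseteq> D" "Poly_Mapping.keys b \<subseteq> D"
      using p q a b by (simp_all add: poly_ring_def)
    ultimately show ?thesis by blast
  qed
  then show "p \<otimes>\<^bsub>poly_ring D\<^esub> q \<in> carrier (poly_ring D)"
    by (simp add: poly_ring_def)
next
  fix p :: "'k tpoly"
  assume "p \<in> carrier (poly_ring D)"
  then show "\<exists>q \<in> carrier (poly_ring D). q \<oplus>\<^bsub>poly_ring D\<^esub> p = \<zero>\<^bsub>poly_ring D\<^esub>"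
    by (intro bexI[of _ "- p"]) (auto simp: poly_ring_def)
qed (auto simp: poly_ring_def algebra_simps)

lemma T_in_poly_ring: "u \<in> D \<Longrightarrow> (T u :: 'k::comm_ring_1 tpoly) \<in> carrier (poly_ring D)"
  by (auto simp: T_def poly_ring_def)

end

theory Submission
  imports Defs "HOL-Library.Function_Algebras" Complex_Main
begin

text \<open>Sending \<open>T (i, j, k)\<close> to the product of three variables \<open>x\<^sub>i\<close>, \<open>y\<^sub>j\<close>, \<open>z\<^sub>k\<close> gives every monomial
  a content, and all 2-minors are differences of monomials with equal content. Call two points of \<open>D\<close>
  clashing if their product is the leading term of a minor that switches second or third coordinates.
  A monomial whose support contains a clash can be replaced by a smaller one of the same content.
  Under the projection property, conversely, a monomial without clashes is determined by its content
  (\<open>reduced_monomial_unique\<close>), hence is the smallest monomial of its content. Therefore the initial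
  ideal is generated by the products of clashing pairs, and \<open>Delta D\<close> is the complex of clash-free
  subsets of \<open>D\<close> (\<open>Delta_eq\<close>).

  Purity and dimension follow by linear algebra (\<open>card_maximal_clash_free\<close>). The contents of a
  clash-free set are linearly independent, as a relation would yield two different reduced monomials
  of the same content. The contents of a maximal clash-free set span those of all points: for
  some exponent, the normal form of the product of a power of the set with another point is supported
  on the set itself. So all facets have the cardinality of one of them, the hook formed by the
  three axes of \<open>D\<close>, which has \<open>num_x D + num_y D + num_z D - 2\<close> points.

  For the vertex decomposition, the points are processed in lexicographic order
  (\<open>vertex_decomposable_by_order\<close>). At a point \<open>v\<close> that is compatible with the set \<open>S\<close> of points
  linked so far, either \<open>v\<close> is compatible with all later points that are still admissible, and the
  remaining complex is a cone, or else \<open>v\<close> can be exchanged: for every set \<open>G\<close> of later points such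
  that \<open>insert v (S \<union> G)\<close> is clash-free, some later point outside \<open>G\<close> can be added to \<open>S \<union> G\<close>
  instead of \<open>v\<close> (\<open>lex_order_shedding\<close>). The new point is a neighbour
  of \<open>v\<close> on the same level, or it is found on a higher level because a clash-free set
  can always be extended by a point with a given permitted coordinate that is not yet in use
  (\<open>extend_by_second_coordinate\<close>).\<close>

section \<open>Vertex decompositions along an ordering of the vertices\<close>

text \<open>This is purity with the common size of the facets made explicit, so that sizes can be
  tracked through links and deletions.\<close>

definition pure_of_size :: "nat \<Rightarrow> 'v set set \<Rightarrow> bool" where
  "pure_of_size n X \<longleftrightarrow> simplicial_complex X \<and> (\<forall>F \<in> facets X. card F = n)"

lemma finite_simplicial_complex: "simplicial_complex X \<Longrightarrow> finite X"
  unfolding simplicial_complex_def by (metis finite_UnionD)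

lemma finite_face: "simplicial_complex X \<Longrightarrow> F \<in> X \<Longrightarrow> finite F"
  unfolding simplicial_complex_def by (metis Union_upper finite_subset)

lemma face_subset_facet:
  assumes "simplicial_complex X" "F \<in> X"
  obtains G where "G \<in> facets X" "F \<subseteq> G"
proof -
  have "finite {G \<in> X. F \<subseteq> G}" "{G \<in> X. F \<subseteq> G} \<noteq> {}"
    using assms finite_simplicial_complex[OF assms(1)] by auto
  then obtain G where "G \<in> {G \<in> X. F \<subseteq> G}" "\<forall>H \<in> {G \<in> X. F \<subseteq> G}. G \<subseteq> H \<longrightarrow> G = H"
    using finite_has_maximal[of "{G \<in> X. F \<subseteq> G}"] by blast
  then show ?thesis
    using that[of G] unfolding facets_def by blast
qed

lemma pure_of_size_card_le:
  assumes "pure_of_size n X" "F \<in> X"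
  shows "card F \<le> n"
  using assms face_subset_facet[of X F] card_mono finite_face
  unfolding pure_of_size_def by (metis (no_types, lifting) facets_def mem_Collect_eq)

lemma pure_of_size_pure: "pure_of_size n X \<Longrightarrow> pure_complex X"
  unfolding pure_of_size_def pure_complex_def by auto

lemma pure_of_size_dim:
  assumes "pure_of_size n X"
  shows "complex_dim X = int n - 1"
proof -
  have sc: "simplicial_complex X"
    using assms unfolding pure_of_size_def by simp
  then obtain F where "F \<in> X"
    unfolding simplicial_complex_def by blast
  then obtain G where G: "G \<in> facets X"
    using face_subset_facet[OF sc] by metis
  then have "int n - 1 \<in> (\<lambda>F. int (card F) - 1) ` X"
    using assms unfolding pure_of_size_def facets_def by auto
  then show ?thesis
    unfolding complex_dim_def
  proof (rule Max_eqI[rotated 2])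
    show "finite ((\<lambda>F. int (card F) - 1) ` X)"
      using finite_simplicial_complex[OF sc] by simp
    fix d assume "d \<in> (\<lambda>F. int (card F) - 1) ` X"
    then obtain F where "F \<in> X" "d = int (card F) - 1" by blast
    then show "d \<le> int n - 1"
      using pure_of_size_card_le[OF assms, of F] by linarith
  qed
qed

lemma pure_complex_pure_of_size:
  assumes "pure_complex X"
  obtains n where "pure_of_size n X"
proof -
  have sc: "simplicial_complex X"
    using assms unfolding pure_complex_def by simp
  then obtain F where "F \<in> X"
    unfolding simplicial_complex_def by blast
  then obtain G where "G \<in> facets X"
    using face_subset_facet[OF sc] by metis
  then have "pure_of_size (card G) X"
    using assms unfolding pure_complex_def pure_of_size_def by blast
  then show ?thesis using that by blast
qed

definition cone :: "'v \<Rightarrow> 'v set set \<Rightarrow> 'v set set" where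
  "cone v X = X \<union> insert v ` X"

lemma mem_cone:
  assumes "v \<notin> \<Union>X"
  shows "F \<in> cone v X \<longleftrightarrow> F - {v} \<in> X"
proof
  assume "F \<in> cone v X"
  then consider "F \<in> X" | G where "G \<in> X" "F = insert v G" unfolding cone_def by auto
  then show "F - {v} \<in> X"
  proof cases
    case 1
    then have "v \<notin> F" using assms by auto
    then show ?thesis using 1 by simp
  next
    case 2
    then have "v \<notin> G" using assms by auto
    then show ?thesis using 2 by simp
  qed
next
  assume F: "F - {v} \<in> X"
  show "F \<in> cone v X"
  proof (cases "v \<in> F")
    case True
    then have "F = insert v (F - {v})" by auto
    then show ?thesis using F unfolding cone_def by blast
  next
    case False
    then show ?thesis using F unfolding cone_def by simp
  qed
qed

lemma cone_Pow: "cone v (Pow V) = Pow (insert v V)"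
  unfolding cone_def by (simp add: Pow_insert)

lemma link_cone:
  assumes "u \<noteq> v"
  shows "link (cone v X) u = cone v (link X u)"
proof (rule Set.set_eqI)
  fix F
  have "(insert u F \<in> insert v ` X) \<longleftrightarrow> F \<in> insert v ` {F. u \<notin> F \<and> insert u F \<in> X}" if uF: "u \<notin> F"
  proof
    assume "insert u F \<in> insert v ` X"
    then obtain G where G: "G \<in> X" "insert u F = insert v G" by blast
    then have "u \<in> G" using assms by auto
    then have "insert u (G - {u}) \<in> X" using G by (simp add: insert_absorb)
    moreover have "F = insert u F - {u}" using uF by simp
    then have "F = insert v (G - {u})" using G(2) assms by auto
    ultimately show "F \<in> insert v ` {F. u \<notin> F \<and> insert u F \<in> X}" by simp
  next
    assume "F \<in> insert v ` {F. u \<notin> F \<and> insert u F \<in> X}"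
    then obtain G where "F = insert v G" "insert u G \<in> X" by auto
    then show "insert u F \<in> insert v ` X" by (auto simp: insert_commute[of u v])
  qed
  then show "F \<in> link (cone v X) u \<longleftrightarrow> F \<in> cone v (link X u)"
    unfolding link_def cone_def using assms by auto
qed

lemma deletion_cone: "u \<noteq> v \<Longrightarrow> deletion (cone v X) u = cone v (deletion X u)"
  unfolding deletion_def cone_def by auto

lemma pure_of_size_cone:
  assumes "pure_of_size n X" "v \<notin> \<Union>X"
  shows "pure_of_size (Suc n) (cone v X)"
proof -
  have sc: "simplicial_complex X"
    using assms unfolding pure_of_size_def by simp
  have sub: "G \<in> cone v X" if FG: "F \<in> cone v X" "G \<subseteq> F" for F G
  proof -
    have "F - {v} \<in> X" "G - {v} \<subseteq> F - {v}" using FG mem_cone[OF assms(2)] by auto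
    then show ?thesis using sc mem_cone[OF assms(2)] unfolding simplicial_complex_def by blast
  qed
  have "\<Union>(cone v X) \<subseteq> insert v (\<Union>X)" "cone v X \<noteq> {}"
    unfolding cone_def using sc unfolding simplicial_complex_def by auto
  moreover have "finite (\<Union>X)" using sc unfolding simplicial_complex_def by auto
  ultimately have scc: "simplicial_complex (cone v X)"
    unfolding simplicial_complex_def using sub finite_subset by blast
  have "card F = Suc n" if F: "F \<in> facets (cone v X)" for F
  proof -
    have "v \<in> F"
    proof (rule ccontr)
      assume "v \<notin> F"
      then have "insert v F \<in> cone v X" using F unfolding facets_def cone_def by auto
      then show False using F \<open>v \<notin> F\<close> unfolding facets_def by blast
    qed
    then obtain G where G: "G \<in> X" "F = insert v G"
      using F assms unfolding facets_def cone_def by blast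
    have "G \<in> facets X"
      unfolding facets_def
    proof (intro CollectI conjI ballI impI G)
      fix H assume H: "H \<in> X" "G \<subseteq> H"
      then have "insert v H \<in> cone v X" unfolding cone_def by blast
      then have "insert v H = insert v G" using F G H unfolding facets_def by blast
      moreover have "v \<notin> H" "v \<notin> G" using H G assms by blast+
      ultimately show "G = H" using insert_ident by metis
    qed
    then have "card G = n" using assms unfolding pure_of_size_def by blast
    moreover have "finite G" "v \<notin> G" using G assms sc finite_face by blast+
    ultimately show ?thesis using G by simp
  qed
  then show ?thesis using scc unfolding pure_of_size_def by blast
qed

text \<open>This is needed because an apex is not a shedding vertex: its deletion has smaller dimension.\<close>

lemma vertex_decomposable_cone:
  assumes "vertex_decomposable X" "v \<notin> \<Union>X"
  shows "vertex_decomposable (cone v X)"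
  using assms
proof (induction rule: vertex_decomposable.induct)
  case empty_face
  have "cone v {{}} = Pow {v}" unfolding cone_def by auto
  then show ?case by (simp add: vertex_decomposable.simplex)
next
  case (simplex V)
  then show ?case by (simp add: cone_Pow vertex_decomposable.simplex)
next
  case (shedding X u)
  have uv: "u \<noteq> v" using shedding by auto
  obtain a where a: "pure_of_size a X" using shedding pure_complex_pure_of_size by blast
  obtain b where b: "pure_of_size b (link X u)" using shedding pure_complex_pure_of_size by blast
  obtain c where c: "pure_of_size c (deletion X u)" using shedding pure_complex_pure_of_size by blast
  have out: "v \<notin> \<Union>(link X u)" "v \<notin> \<Union>(deletion X u)"
    using shedding.prems unfolding link_def deletion_def by auto
  have "a = b + 1" "a = c"
    using shedding.hyps pure_of_size_dim[OF a] pure_of_size_dim[OF b] pure_of_size_dim[OF c] by auto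
  note pures = pure_of_size_cone[OF a shedding.prems] pure_of_size_cone[OF b out(1)]
    pure_of_size_cone[OF c out(2)]
  show ?case
  proof (rule vertex_decomposable.shedding[of _ u])
    show "{u} \<in> cone v X" using shedding unfolding cone_def by simp
  qed (use pures shedding.IH out \<open>a = b + 1\<close> \<open>a = c\<close> in
      \<open>auto simp: link_cone[OF uv] deletion_cone[OF uv] pure_of_size_dim intro: pure_of_size_pure\<close>)
qed

text \<open>The complex that remains when the vertices outside \<open>W\<close> have been processed, of which those in
  \<open>S\<close> were passed to the link and the others deleted.\<close>

definition remaining :: "'v set set \<Rightarrow> 'v set \<Rightarrow> 'v set \<Rightarrow> 'v set set" where
  "remaining X S W = {G. G \<subseteq> W \<and> S \<union> G \<in> X}"

lemma simplicial_complex_remaining: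
  assumes "simplicial_complex X" "S \<in> X" "finite W"
  shows "simplicial_complex (remaining X S W)"
proof -
  have "\<Union>(remaining X S W) \<subseteq> W" unfolding remaining_def by auto
  moreover have "{} \<in> remaining X S W" unfolding remaining_def using assms by simp
  moreover have "H \<in> remaining X S W" if "G \<in> remaining X S W" "H \<subseteq> G" for G H
  proof -
    have "S \<union> H \<subseteq> S \<union> G" "S \<union> G \<in> X" "H \<subseteq> W" using that unfolding remaining_def by auto
    then show ?thesis using assms(1) unfolding remaining_def simplicial_complex_def by blast
  qed
  ultimately show ?thesis
    unfolding simplicial_complex_def using assms(3) finite_subset by blast
qed

text \<open>Walk through the vertices in the given order. At a vertex \<open>v\<close> that can be added to the set
  \<open>S\<close> chosen so far, the remaining complex is either a cone with apex \<open>v\<close>, or no facet of the link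
  of \<open>v\<close> is a facet of the deletion. In the second case every facet of the deletion is a facet of the
  remaining complex, so that purity passes to the deletion, and \<open>v\<close> is a shedding vertex.\<close>

lemma vertex_decomposable_by_order:
  assumes sc: "pure_of_size n X"
    and "distinct vs" and verts: "\<And>F. F \<in> X \<Longrightarrow> F \<subseteq> set vs"
    and step: "\<And>us v ws S. \<lbrakk>vs = us @ v # ws; S \<subseteq> set us; insert v S \<in> X\<rbrakk> \<Longrightarrow>
      (\<forall>G \<subseteq> set ws. S \<union> G \<in> X \<longrightarrow> insert v (S \<union> G) \<in> X) \<or>
      (\<forall>G \<subseteq> set ws. insert v (S \<union> G) \<in> X \<longrightarrow> (\<exists>w \<in> set ws - G. insert w (S \<union> G) \<in> X))"
  shows "vertex_decomposable X"
proof -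
  have scX: "simplicial_complex X" using sc unfolding pure_of_size_def by simp
  have down: "B \<in> X" if "A \<in> X" "B \<subseteq> A" for A B
    using scX that unfolding simplicial_complex_def by blast
  have "vertex_decomposable (remaining X S (set ws))"
    if "vs = us @ ws" "S \<subseteq> set us" "S \<in> X" "pure_of_size d (remaining X S (set ws))" for us ws S d
    using that
  proof (induction ws arbitrary: us S d)
    case Nil
    then have "remaining X S (set []) = {{}}" unfolding remaining_def by auto
    then show ?case using vertex_decomposable.empty_face by simp
  next
    case (Cons v ws)
    let ?R = "remaining X S (set (v # ws))"
    have v: "v \<notin> set us" "v \<notin> set ws" using Cons.prems \<open>distinct vs\<close> by auto
    then have vS: "v \<notin> S" using Cons.prems by auto
    have split: "vs = (us @ [v]) @ ws" using Cons.prems by simp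
    show ?case
    proof (cases "insert v S \<in> X")
      case False
      then have "v \<notin> G" if "S \<union> G \<in> X" for G
        using down[OF that, of "insert v S"] by blast
      then have "?R = remaining X S (set ws)"
        unfolding remaining_def by auto
      then show ?thesis
        using Cons.IH[OF split _ Cons.prems(3)] Cons.prems by auto
    next
      case True
      let ?L = "remaining X (insert v S) (set ws)"
      let ?D = "remaining X S (set ws)"
      have link: "link ?R v = ?L"
        unfolding link_def remaining_def using v by auto
      have del: "deletion ?R v = ?D"
        unfolding deletion_def remaining_def using v by auto
      have scL: "simplicial_complex ?L" and scD: "simplicial_complex ?D"
        using simplicial_complex_remaining[OF scX] True Cons.prems by auto
      have "Suc (card G) = d" if G: "G \<in> facets ?L" for G
      proof -
        have GL: "G \<subseteq> set ws" "insert v (S \<union> G) \<in> X"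
          using G unfolding facets_def remaining_def by auto
        have "insert v G \<in> facets ?R"
          unfolding facets_def
        proof (intro CollectI conjI ballI impI)
          show "insert v G \<in> ?R" using GL unfolding remaining_def by auto
          fix H assume H: "H \<in> ?R" "insert v G \<subseteq> H"
          then have "insert v S \<union> (H - {v}) = S \<union> H" by auto
          then have "H - {v} \<in> ?L" using H unfolding remaining_def by auto
          moreover have "G \<subseteq> H - {v}" using H GL v by auto
          ultimately have "G = H - {v}" using G unfolding facets_def by blast
          then show "insert v G = H" using H by auto
        qed
        then have "card (insert v G) = d" using Cons.prems unfolding pure_of_size_def by blast
        moreover have "v \<notin> G" "finite G" using GL v finite_subset by auto
        ultimately show ?thesis by simp
      qed
      moreover obtain G where "G \<in> facets ?L"
        using face_subset_facet[OF scL, of "{}"] True unfolding remaining_def by auto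
      ultimately obtain e where e: "d = Suc e" and pL: "pure_of_size e ?L"
        using scL unfolding pure_of_size_def by (metis nat.inject)
      have vdL: "vertex_decomposable ?L"
        using Cons.IH[OF split _ True pL] Cons.prems by auto
      show ?thesis
      proof (cases "\<forall>G \<subseteq> set ws. S \<union> G \<in> X \<longrightarrow> insert v (S \<union> G) \<in> X")
        case True
        have apex: "v \<notin> \<Union>?L" using v unfolding remaining_def by auto
        have "?R = cone v ?L"
        proof (rule Set.set_eqI)
          fix F
          have "F \<in> ?R \<longleftrightarrow> F - {v} \<in> ?L"
          proof
            assume "F \<in> ?R"
            then have F: "F - {v} \<subseteq> set ws" "S \<union> F \<in> X" unfolding remaining_def by auto
            from F(2) have "S \<union> (F - {v}) \<in> X" by (rule down) blast
            then show "F - {v} \<in> ?L" using True F(1) unfolding remaining_def by simp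
          next
            assume "F - {v} \<in> ?L"
            then have F: "F - {v} \<subseteq> set ws" "insert v S \<union> (F - {v}) \<in> X" unfolding remaining_def by auto
            from F(2) have "S \<union> F \<in> X" by (rule down) blast
            then show "F \<in> ?R" using F(1) unfolding remaining_def by auto
          qed
          then show "F \<in> ?R \<longleftrightarrow> F \<in> cone v ?L" using mem_cone[OF apex] by blast
        qed
        then show ?thesis using vertex_decomposable_cone[OF vdL apex] by simp
      next
        case False
        have exch: "\<exists>w \<in> set ws - G. insert w (S \<union> G) \<in> X"
          if "G \<subseteq> set ws" "insert v (S \<union> G) \<in> X" for G
          using step[OF Cons.prems(1) Cons.prems(2) True] False that by blast
        have "card G = d" if G: "G \<in> facets ?D" for G
        proof -
          have GD: "G \<subseteq> set ws" "S \<union> G \<in> X"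
            using G unfolding facets_def remaining_def by auto
          have "G \<in> facets ?R"
            unfolding facets_def
          proof (intro CollectI conjI ballI impI)
            show "G \<in> ?R" using GD unfolding remaining_def by auto
            fix H assume H: "H \<in> ?R" "G \<subseteq> H"
            have "v \<notin> H"
            proof
              assume "v \<in> H"
              then have "insert v (S \<union> G) \<subseteq> S \<union> H" "S \<union> H \<in> X" using H unfolding remaining_def by auto
              then have "insert v (S \<union> G) \<in> X" using down by blast
              then obtain w where w: "w \<in> set ws - G" "insert w (S \<union> G) \<in> X"
                using exch GD by blast
              then have "insert w G \<in> ?D" using GD unfolding remaining_def by auto
              then show False using G w unfolding facets_def by blast
            qed
            then have "H \<in> ?D" using H unfolding remaining_def by auto
            then show "G = H" using G H unfolding facets_def by blast
          qed
          then show ?thesis using Cons.prems unfolding pure_of_size_def by blast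
        qed
        then have pD: "pure_of_size d ?D" using scD unfolding pure_of_size_def by blast
        have vdD: "vertex_decomposable ?D"
          using Cons.IH[OF split _ _ pD] Cons.prems by auto
        show ?thesis
        proof (rule vertex_decomposable.shedding[of _ v])
          show "{v} \<in> ?R" using True unfolding remaining_def by simp
        qed (use pL pD Cons.prems(4) vdL vdD e in
            \<open>auto simp: link[simplified] del[simplified] pure_of_size_dim intro: pure_of_size_pure\<close>)
      qed
    qed
  qed
  moreover have "remaining X {} (set vs) = X"
    unfolding remaining_def using verts by auto
  moreover have "{} \<in> X" using scX down unfolding simplicial_complex_def by blast
  ultimately show ?thesis using sc by (metis append_Nil empty_subsetI)
qed

section \<open>Clashing points and their independent sets\<close>

text \<open>The products \<open>T u * T v\<close> of clashing points are the leading terms of the nonzero 2-minors that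
  switch second or third coordinates. On a common level these two switches coincide. If \<open>D\<close> has the
  projection property, the leading terms of the minors that switch first coordinates are among them.\<close>

fun clash :: "point set \<Rightarrow> point \<Rightarrow> point \<Rightarrow> bool" where
  "clash D (i1, j1, k1) (i2, j2, k2) \<longleftrightarrow>
     i1 = i2 \<and> j1 < j2 \<and> k1 < k2 \<or>
     i1 < i2 \<and> (j1 < j2 \<and> (i1, j2, k1) \<in> D \<or> k1 < k2 \<and> (i1, j1, k2) \<in> D)"

definition clash_free :: "point set \<Rightarrow> point set \<Rightarrow> bool" where
  "clash_free D F \<longleftrightarrow> F \<subseteq> D \<and> (\<forall>u \<in> F. \<forall>v \<in> F. \<not> clash D u v)"

lemma clash_freeD: "clash_free D F \<Longrightarrow> u \<in> F \<Longrightarrow> v \<in> F \<Longrightarrow> \<not> clash D u v"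
  unfolding clash_free_def by blast

lemma clash_free_subset: "clash_free D F \<Longrightarrow> G \<subseteq> F \<Longrightarrow> clash_free D G"
  unfolding clash_free_def by blast

lemma not_clash_refl [simp]: "\<not> clash D u u"
  by (cases u) auto

lemma clash_free_insert:
  assumes "clash_free D F" "w \<in> D" "\<And>u. u \<in> F \<Longrightarrow> \<not> clash D u w \<and> \<not> clash D w u"
  shows "clash_free D (insert w F)"
  using assms unfolding clash_free_def by auto

lemma clash_less: "clash D u v \<Longrightarrow> u < v"
  by (cases u; cases v) (auto simp: less_prod_def)

lemma ferrers_down:
  "\<lbrakk>ferrers_diagram D; (i0, j0, k0) \<in> D; 1 \<le> i; i \<le> i0; 1 \<le> j; j \<le> j0; 1 \<le> k; k \<le> k0\<rbrakk> \<Longrightarrow> (i, j, k) \<in> D"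
  unfolding ferrers_diagram_def by blast

lemma ferrers_pos: "ferrers_diagram D \<Longrightarrow> (i, j, k) \<in> D \<Longrightarrow> 1 \<le> i \<and> 1 \<le> j \<and> 1 \<le> k"
  unfolding ferrers_diagram_def by auto

text \<open>Second and third coordinates play symmetric roles.\<close>

fun swap23 :: "point \<Rightarrow> point" where
  "swap23 (i, j, k) = (i, k, j)"

lemma swap23_swap23 [simp]: "swap23 (swap23 u) = u"
  by (cases u) auto

lemma mem_swap23_image [simp]: "u \<in> swap23 ` A \<longleftrightarrow> swap23 u \<in> A"
  by (metis image_iff swap23_swap23)

lemma clash_swap23 [simp]: "clash (swap23 ` D) (swap23 u) (swap23 v) \<longleftrightarrow> clash D u v"
  by (cases u; cases v) auto

lemma clash_free_swap23 [simp]: "clash_free (swap23 ` D) (swap23 ` F) \<longleftrightarrow> clash_free D F"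
  unfolding clash_free_def by (auto simp: image_subset_iff)

lemma ferrers_swap23:
  assumes "ferrers_diagram D"
  shows "ferrers_diagram (swap23 ` D)"
  unfolding ferrers_diagram_def
proof (intro conjI ballI)
  show "finite (swap23 ` D)" "swap23 ` D \<noteq> {}"
    using assms unfolding ferrers_diagram_def by auto
  fix u assume u: "u \<in> swap23 ` D"
  obtain i0 j0 k0 where u_eq: "u = (i0, j0, k0)" by (cases u)
  have uD: "(i0, k0, j0) \<in> D" using u unfolding u_eq by simp
  show "case u of (i, j, k) \<Rightarrow> 1 \<le> i \<and> 1 \<le> j \<and> 1 \<le> k"
    using ferrers_pos[OF assms uD] unfolding u_eq by simp
  show "case u of (i0, j0, k0) \<Rightarrow> \<forall>i j k. 1 \<le> i \<and> i \<le> i0 \<and> 1 \<le> j \<and> j \<le> j0 \<and> 1 \<le> k \<and> k \<le> k0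
    \<longrightarrow> (i, j, k) \<in> swap23 ` D"
    using ferrers_down[OF assms uD] unfolding u_eq by simp
qed

section \<open>Extending independent sets by a prescribed coordinate\<close>

text \<open>The new point is put on the first level \<open>i > i0\<close> that either forbids the coordinate \<open>y\<close> on all
  higher levels or is the last one where \<open>y\<close> occurs. Its third coordinate is chosen as large as the
  points of lower levels and the points of level \<open>i\<close> with smaller second coordinate permit. Maximality
  excludes clashes with third coordinates of higher levels, and with second coordinates because some
  point of level \<open>i\<close> already forbids \<open>y\<close> there.\<close>

lemma extend_by_second_coordinate:
  assumes D: "ferrers_diagram D" and F: "clash_free D F"
    and low: "\<And>i j k. (i, j, k) \<in> F \<Longrightarrow> i \<le> i0 \<Longrightarrow> y \<le> j \<or> (i, y, k) \<notin> D"
    and occurs: "(Suc i0, y, 1) \<in> D"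
    and unused: "\<And>i j k. (i, j, k) \<in> F \<Longrightarrow> i0 < i \<Longrightarrow> j \<noteq> y"
  shows "\<exists>i z. i0 < i \<and> (i, y, z) \<in> D \<and> clash_free D (insert (i, y, z) F)"
proof -
  note down = ferrers_down[OF D] and pos = ferrers_pos[OF D]
  have FD: "u \<in> D" if "u \<in> F" for u using F that unfolding clash_free_def by auto
  have y: "1 \<le> y" using pos[OF occurs] by simp
  have finD: "finite D" using D unfolding ferrers_diagram_def by simp
  define stop where "stop i \<longleftrightarrow> i0 < i \<and>
    ((Suc i, y, 1) \<notin> D \<or> (\<exists>j k. (i, j, k) \<in> F \<and> j < y \<and> (i, y, k) \<in> D))" for i
  have "\<exists>i. stop i"
  proof (rule ccontr)
    assume "\<not> (\<exists>i. stop i)"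
    then have "(\<lambda>i. (Suc i, y, 1)) ` {i0<..} \<subseteq> D" unfolding stop_def by auto
    then have "finite ((\<lambda>i. (Suc i, y, 1::nat)) ` {i0<..})" using finD finite_subset by blast
    then have "finite {i0<..}" by (rule finite_imageD) (auto simp: inj_on_def)
    then show False using infinite_Ioi by blast
  qed
  define i where "i = (LEAST i. stop i)"
  have i: "stop i" unfolding i_def using \<open>\<exists>i. stop i\<close> by (metis LeastI)
  have before: "\<not> stop i'" if "i' < i" for i' using that unfolding i_def by (metis not_less_Least)
  have "i0 < i" using i unfolding stop_def by simp
  have iy: "(i, y, 1) \<in> D"
  proof (cases "i = Suc i0")
    case False
    then have "i0 < i - 1" "i - 1 < i" using \<open>i0 < i\<close> by auto
    then show ?thesis using before[of "i - 1"] unfolding stop_def by auto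
  qed (use occurs in simp)
  have lowy: "y \<le> j \<or> (i', y, k) \<notin> D" if "(i', j, k) \<in> F" "i' < i" for i' j k
    using low[OF that(1)] before[OF that(2)] that(1) unfolding stop_def
    by (cases "i' \<le> i0") (auto simp: not_le)
  define C where "C = {z. (i, y, z) \<in> D \<and> (\<forall>i' j k. (i', j, k) \<in> F \<and> i' < i \<longrightarrow> z \<le> k \<or> (i', j, z) \<notin> D)
    \<and> (\<forall>j k. (i, j, k) \<in> F \<and> j < y \<longrightarrow> z \<le> k)}"
  have "C \<subseteq> (\<lambda>(i, j, k). k) ` D" unfolding C_def by force
  then have finC: "finite C" using finD finite_subset by blast
  have "1 \<le> k" if "(i', j, k) \<in> F" for i' j k using pos[OF FD[OF that]] by simp
  then have "1 \<in> C" unfolding C_def using iy by blast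
  define z where "z = Max C"
  have zC: "z \<in> C" unfolding z_def using finC \<open>1 \<in> C\<close> Max_in by blast
  have zmax: "z' \<le> z" if "z' \<in> C" for z' unfolding z_def using finC that by simp
  have wD: "(i, y, z) \<in> D" using zC unfolding C_def by simp
  have "\<not> clash D u (i, y, z) \<and> \<not> clash D (i, y, z) u" if uF: "u \<in> F" for u
  proof -
    obtain i' j k where u: "u = (i', j, k)" by (cases u)
    have uF': "(i', j, k) \<in> F" using uF u by simp
    have kC: "k \<in> C" if "(i, y, k) \<in> D" "\<And>j' k'. (i, j', k') \<in> F \<Longrightarrow> j' < y \<Longrightarrow> k \<le> k'" "i \<le> i'"
      unfolding C_def
    proof (intro CollectI conjI allI impI)
      fix i2 j2 k2 assume "(i2, j2, k2) \<in> F \<and> i2 < i"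
      then show "k \<le> k2 \<or> (i2, j2, k) \<notin> D"
        using clash_freeD[OF F _ uF', of "(i2, j2, k2)"] that(3) by auto
    qed (use that in auto)
    consider "i' < i" | "i' = i" | "i < i'" by linarith
    then show ?thesis
    proof cases
      case 1
      then have "z \<le> k \<or> (i', j, z) \<notin> D" using zC uF' unfolding C_def by blast
      then show ?thesis using 1 lowy[OF uF' 1] unfolding u by auto
    next
      case 2
      have "j \<noteq> y" using unused uF' 2 \<open>i0 < i\<close> by blast
      have "k \<le> z" if "y < j"
      proof (rule zmax, rule kC)
        show "(i, y, k) \<in> D" using down[of i j k i y k] FD[OF uF'] pos[OF FD[OF uF']] 2 y that by auto
        fix j' k' assume "(i, j', k') \<in> F" "j' < y"
        then show "k \<le> k'" using clash_freeD[OF F _ uF', of "(i, j', k')"] 2 that by auto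
      qed (use 2 in simp)
      moreover have "z \<le> k" if "j < y" using zC uF' 2 that unfolding C_def by blast
      ultimately show ?thesis using 2 \<open>j \<noteq> y\<close> unfolding u by auto
    next
      case 3
      have "\<not> (z < k \<and> (i, y, k) \<in> D)"
      proof
        assume zk: "z < k \<and> (i, y, k) \<in> D"
        then have "k \<notin> C" using zmax leD by blast
        then obtain j' k' where jk: "(i, j', k') \<in> F" "j' < y" "k' < k"
          using kC zk 3 by (metis leI less_imp_le)
        moreover have "(i, j', k) \<in> D" using down[of i y k i j' k] zk jk pos[OF FD[OF jk(1)]] pos[of i y k] by auto
        ultimately show False using clash_freeD[OF F jk(1) uF'] 3 by auto
      qed
      moreover have "\<not> (y < j \<and> (i, j, z) \<in> D)"
      proof
        assume yj: "y < j \<and> (i, j, z) \<in> D"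
        have "(Suc i, y, 1) \<in> D"
          using down[of i' j k "Suc i" y 1] FD[OF uF'] pos[OF FD[OF uF']] 3 y yj by auto
        then obtain j1 k1 where jk1: "(i, j1, k1) \<in> F" "j1 < y" "(i, y, k1) \<in> D"
          using i unfolding stop_def by blast
        define K where "K = {k. \<exists>j. (i, j, k) \<in> F \<and> j < y}"
        have "K \<subseteq> (\<lambda>(i, j, k). k) ` D" unfolding K_def using FD by force
        then have "finite K" using finD finite_subset by blast
        define k2 where "k2 = Min K"
        have "k1 \<in> K" unfolding K_def using jk1 by auto
        then have "k2 \<in> K" "k2 \<le> k1" unfolding k2_def using \<open>finite K\<close> by (auto intro: Min_in)
        then obtain j2 where j2: "(i, j2, k2) \<in> F" "j2 < y" unfolding K_def by blast
        have "k2 \<in> C"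
          unfolding C_def
        proof (intro CollectI conjI allI impI)
          show "(i, y, k2) \<in> D"
            using down[of i y k1 i y k2] jk1 \<open>k2 \<le> k1\<close> pos[OF FD[OF j2(1)]] y by auto
          fix i3 j3 k3 assume "(i3, j3, k3) \<in> F \<and> i3 < i"
          then show "k2 \<le> k3 \<or> (i3, j3, k2) \<notin> D"
            using clash_freeD[OF F _ j2(1), of "(i3, j3, k3)"] by auto
        next
          fix j3 k3 assume "(i, j3, k3) \<in> F \<and> j3 < y"
          then have "k3 \<in> K" unfolding K_def by auto
          then show "k2 \<le> k3" unfolding k2_def using \<open>finite K\<close> by simp
        qed
        moreover have "z \<le> k2" using zC j2 unfolding C_def by auto
        ultimately have "z = k2" using zmax by (simp add: le_antisym)
        then show False using clash_freeD[OF F j2(1) uF'] 3 j2 yj by auto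
      qed
      ultimately show ?thesis using 3 unfolding u by auto
    qed
  qed
  then have "clash_free D (insert (i, y, z) F)" using clash_free_insert[OF F wD] by blast
  then show ?thesis using wD \<open>i0 < i\<close> by blast
qed

lemma extend_by_third_coordinate:
  assumes D: "ferrers_diagram D" and F: "clash_free D F"
    and low: "\<And>i j k. (i, j, k) \<in> F \<Longrightarrow> i \<le> i0 \<Longrightarrow> z \<le> k \<or> (i, j, z) \<notin> D"
    and occurs: "(Suc i0, 1, z) \<in> D"
    and unused: "\<And>i j k. (i, j, k) \<in> F \<Longrightarrow> i0 < i \<Longrightarrow> k \<noteq> z"
  shows "\<exists>i y. i0 < i \<and> (i, y, z) \<in> D \<and> clash_free D (insert (i, y, z) F)"
proof -
  have F': "clash_free (swap23 ` D) (swap23 ` F)" using F by simp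
  have "\<exists>i y. i0 < i \<and> (i, z, y) \<in> swap23 ` D \<and> clash_free (swap23 ` D) (insert (i, z, y) (swap23 ` F))"
  proof (rule extend_by_second_coordinate[OF ferrers_swap23[OF D] F'])
    fix i j k assume "(i, j, k) \<in> swap23 ` F"
    then have *: "(i, k, j) \<in> F" by simp
    show "i \<le> i0 \<Longrightarrow> z \<le> j \<or> (i, z, k) \<notin> swap23 ` D" using low[OF *] by simp
    show "i0 < i \<Longrightarrow> j \<noteq> z" using unused[OF *] by simp
  qed (use occurs in simp)
  then obtain i y where iy: "i0 < i" "(i, z, y) \<in> swap23 ` D"
      "clash_free (swap23 ` D) (insert (i, z, y) (swap23 ` F))" by blast
  have "insert (i, z, y) (swap23 ` F) = swap23 ` insert (i, y, z) F" by simp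
  then have "clash_free D (insert (i, y, z) F)" using iy(3) by (simp only: clash_free_swap23)
  moreover have "(i, y, z) \<in> D" using iy(2) by (simp only: mem_swap23_image swap23.simps)
  ultimately show ?thesis using iy(1) by blast
qed

section \<open>The shedding condition in lexicographic order\<close>

text \<open>Let \<open>v = (i, j, k)\<close>, and let \<open>y1\<close> and \<open>z1\<close> be the coordinates following \<open>j\<close> and \<open>k\<close> among those
  permitted by the points of \<open>S\<close> on lower levels. If \<open>(i, y1, z1)\<close> lies in \<open>D\<close> and clashes with
  nothing in \<open>S\<close>, then it clashes with nothing in \<open>G\<close> either, because \<open>v\<close> does not. Otherwise \<open>w0\<close>
  lies on a higher level, and \<open>v\<close> is the only obstacle to using \<open>y1\<close> as a second coordinate, or
  \<open>z1\<close> as a third one, on higher levels.\<close>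

lemma lex_order_shedding:
  assumes D: "ferrers_diagram D"
    and S: "\<And>s. s \<in> S \<Longrightarrow> s < v" and G: "\<And>g. g \<in> G \<Longrightarrow> v < g"
    and SG: "clash_free D (insert v (S \<union> G))"
    and w0: "v < w0" "clash_free D (insert w0 S)" "clash D v w0"
  shows "\<exists>w. v < w \<and> w \<notin> G \<and> w \<in> D \<and> clash_free D (insert w (S \<union> G))"
proof -
  note down = ferrers_down[OF D] and pos = ferrers_pos[OF D]
  obtain i j k where v: "v = (i, j, k)" by (cases v)
  obtain i' j' k' where w0_eq: "w0 = (i', j', k')" by (cases w0)
  have inD: "u \<in> D" if "u \<in> insert v (S \<union> G)" for u
    using SG that unfolding clash_free_def by blast
  have w0D: "(i', j', k') \<in> D" using w0 w0_eq unfolding clash_free_def by auto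
  have vD: "(i, j, k) \<in> D" using inD v by simp
  have SGF: "clash_free D (S \<union> G)" using SG by (rule clash_free_subset) auto
  have cv: "\<not> clash D u v" "\<not> clash D v u" if "u \<in> S \<union> G" for u
    using clash_freeD[OF SG] that by auto
  have cw0: "\<not> clash D u w0" if "u \<in> S" for u
    using clash_freeD[OF w0(2)] that by auto
  have cSG: "\<not> clash D u w" if "u \<in> S \<union> G" "w \<in> S \<union> G" for u w
    using clash_freeD[OF SGF] that by auto
  define Y where "Y = {y. \<forall>i2 j2 k2. (i2, j2, k2) \<in> S \<and> i2 < i \<longrightarrow> y \<le> j2 \<or> (i2, y, k2) \<notin> D}"
  define Z where "Z = {z. \<forall>i2 j2 k2. (i2, j2, k2) \<in> S \<and> i2 < i \<longrightarrow> z \<le> k2 \<or> (i2, j2, z) \<notin> D}"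
  have coords: "b \<in> Y \<and> c \<in> Z"
    if "u = (a, b, c)" "i \<le> a" "u \<in> S \<union> G \<or> u = w0" for u a b c
  proof -
    have "(b \<le> j2 \<or> (i2, b, k2) \<notin> D) \<and> (c \<le> k2 \<or> (i2, j2, c) \<notin> D)"
      if s: "(i2, j2, k2) \<in> S" "i2 < i" for i2 j2 k2
    proof -
      have "\<not> clash D (i2, j2, k2) u"
        using cSG[of "(i2, j2, k2)" u] cw0[OF s(1)] s \<open>u \<in> S \<union> G \<or> u = w0\<close> by blast
      then show ?thesis using \<open>u = (a, b, c)\<close> \<open>i \<le> a\<close> s(2) by auto
    qed
    then show ?thesis unfolding Y_def Z_def by blast
  qed
  have coordY: "b \<in> Y" and coordZ: "c \<in> Z"
    if "u = (a, b, c)" "i \<le> a" "u \<in> S \<union> G \<or> u = w0" for u a b c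
    using coords[OF that] by auto
  have "i \<le> i'" using w0(3) unfolding v w0_eq by auto
  have Slevel: "j2 < j \<and> k \<le> k2" if "(i, j2, k2) \<in> S" for j2 k2
  proof -
    have "(i, j2, k2) < (i, j, k)" using S that v by blast
    then have lt: "j2 < j \<or> j2 = j \<and> k2 < k" by (auto simp: less_prod_def)
    have ncl: "\<not> clash D (i, j2, k2) w0" using cw0 that by blast
    have pos2: "1 \<le> i" "1 \<le> j2" "1 \<le> k2" using inD that pos by blast+
    have "j2 < j"
    proof (rule ccontr)
      assume "\<not> j2 < j"
      then have j2: "j2 = j" "k2 < k" using lt by auto
      \<comment> \<open>A smaller point in the column of \<open>v\<close> clashes with everything that \<open>v\<close> clashes with.\<close>
      then have "clash D (i, j2, k2) w0"
        using w0(3) down[of i j' k i j' k2] pos2 pos[OF w0D] unfolding v w0_eq by auto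
      then show False using ncl by simp
    qed
    moreover have "\<not> clash D (i, j2, k2) v" using cv that by blast
    ultimately show ?thesis unfolding v by auto
  qed
  have Glevel: "j2 = j \<and> k < k2 \<or> j < j2 \<and> k2 \<le> k" if "(i, j2, k2) \<in> G" for j2 k2
  proof -
    have "(i, j, k) < (i, j2, k2)" using G that v by blast
    then have "j < j2 \<or> j2 = j \<and> k < k2" by (auto simp: less_prod_def)
    then show ?thesis using cv(2)[of "(i, j2, k2)"] that unfolding v by auto
  qed
  have Ghigh: "i \<le> i2" if "(i2, j2, k2) \<in> G" for i2 j2 k2
    using G[OF that] unfolding v by (auto simp: less_prod_def)
  have Slow: "i2 \<le> i" if "(i2, j2, k2) \<in> S" for i2 j2 k2
    using S[OF that] unfolding v by (auto simp: less_prod_def)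
  let ?corner = "(\<forall>j2 k2. (i, j2, k2) \<in> S \<longrightarrow> k < k2) \<and> (\<exists>y \<in> Y. \<exists>z \<in> Z. j < y \<and> k < z \<and> (i, y, z) \<in> D)"
  define y1 where "y1 = (LEAST y. y \<in> Y \<and> j < y)"
  define z1 where "z1 = (LEAST z. z \<in> Z \<and> k < z)"
  have y1: "y1 \<in> Y \<and> j < y1" if "y \<in> Y" "j < y" for y
    unfolding y1_def using LeastI[of "\<lambda>y. y \<in> Y \<and> j < y" y] that by blast
  have y1_le: "y1 \<le> y" if "y \<in> Y" "j < y" for y
    unfolding y1_def using that by (intro Least_le) auto
  have z1: "z1 \<in> Z \<and> k < z1" if "z \<in> Z" "k < z" for z
    unfolding z1_def using LeastI[of "\<lambda>z. z \<in> Z \<and> k < z" z] that by blast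
  have z1_le: "z1 \<le> z" if "z \<in> Z" "k < z" for z
    unfolding z1_def using that by (intro Least_le) auto
  show ?thesis
  proof (cases ?corner)
    case True
    then obtain y z where yz: "y \<in> Y" "z \<in> Z" "j < y" "k < z" "(i, y, z) \<in> D" by blast
    let ?w = "(i, y1, z1)"
    have wD: "?w \<in> D"
      using down[OF yz(5), of i y1 z1] y1 y1_le z1 z1_le yz pos[OF vD] by force
    have "\<not> clash D u ?w \<and> \<not> clash D ?w u" if u: "u \<in> S \<union> G" for u
    proof -
      obtain i2 j2 k2 where u_eq: "u = (i2, j2, k2)" by (cases u)
      consider "i2 < i" | "i2 = i" "u \<in> S" | "i2 = i" "u \<in> G" | "i < i2" by (metis u Un_iff linorder_neqE_nat)
      then show ?thesis
      proof cases
        case 1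
        then have "(i2, j2, k2) \<in> S" using u Ghigh[of i2 j2 k2] u_eq by auto
        then have "y1 \<le> j2 \<or> (i2, y1, k2) \<notin> D" "z1 \<le> k2 \<or> (i2, j2, z1) \<notin> D"
          using 1 y1[OF yz(1,3)] z1[OF yz(2,4)] unfolding Y_def Z_def by blast+
        then show ?thesis using 1 unfolding u_eq by auto
      next
        case 2
        then have "j2 < j" "k < k2" using Slevel True u_eq by auto
        moreover have "z1 \<le> k2" using z1_le coordZ[OF u_eq _ disjI1[OF u]] 2 calculation by simp
        ultimately show ?thesis using 2 y1[OF yz(1,3)] unfolding u_eq by auto
      next
        case 3
        have "z1 \<le> k2" if "k < k2" using z1_le coordZ[OF u_eq _ disjI1[OF u]] 3 that by simp
        moreover have "y1 \<le> j2" if "j < j2" using y1_le coordY[OF u_eq _ disjI1[OF u]] 3 that by simp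
        ultimately show ?thesis
          using Glevel[of j2 k2] 3 y1[OF yz(1,3)] z1[OF yz(2,4)] unfolding u_eq by auto
      next
        case 4
        have "\<not> (y1 < j2 \<and> (i, j2, z1) \<in> D)"
        proof
          assume a: "y1 < j2 \<and> (i, j2, z1) \<in> D"
          then have "(i, j2, k) \<in> D"
            using down[of i j2 z1 i j2 k] pos[OF vD] y1[OF yz(1,3)] z1[OF yz(2,4)] by auto
          then show False using cv(2)[OF u] 4 a y1[OF yz(1,3)] unfolding v u_eq by auto
        qed
        moreover have "\<not> (z1 < k2 \<and> (i, y1, k2) \<in> D)"
        proof
          assume a: "z1 < k2 \<and> (i, y1, k2) \<in> D"
          then have "(i, j, k2) \<in> D"
            using down[of i y1 k2 i j k2] pos[OF vD] y1[OF yz(1,3)] z1[OF yz(2,4)] by auto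
          then show False using cv(2)[OF u] 4 a z1[OF yz(2,4)] unfolding v u_eq by auto
        qed
        ultimately show ?thesis using 4 unfolding u_eq by auto
      qed
    qed
    then have "clash_free D (insert ?w (S \<union> G))" using clash_free_insert[OF SGF wD] by blast
    moreover have "clash D v ?w" using y1[OF yz(1,3)] z1[OF yz(2,4)] unfolding v by auto
    ultimately show ?thesis using wD clash_less cv(2) by blast
  next
    case False
    have w0Y: "j' \<in> Y" and w0Z: "k' \<in> Z" using coordY coordZ \<open>i \<le> i'\<close> w0_eq by blast+
    have "i < i'"
    proof (rule ccontr)
      assume "\<not> i < i'"
      then have "i' = i" "j < j'" "k < k'" using w0(3) unfolding v w0_eq by auto
      moreover have "k < k2" if "(i, j2, k2) \<in> S" for j2 k2
        using cw0[OF that] Slevel[OF that] calculation unfolding w0_eq by auto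
      ultimately show False using False w0Y w0Z w0D by blast
    qed
    then consider "j < j'" "(i, j', k) \<in> D" | "k < k'" "(i, j, k') \<in> D"
      using w0(3) unfolding v w0_eq by auto
    then show ?thesis
    proof cases
      case 1
      have Sk: "k < k2" if "(i, j2, k2) \<in> S" for j2 k2
        using cw0[OF that] Slevel[OF that] 1 \<open>i < i'\<close> unfolding w0_eq by (cases "k = k2") auto
      note y1' = y1[OF w0Y 1(1)] y1_le[OF w0Y 1(1)]
      have no_corner: "(i, y1, z) \<notin> D" if "z \<in> Z" "k < z" for z
        using False Sk y1' that by blast
      have y1D: "(i, y1, k) \<in> D" using down[OF 1(2), of i y1 k] y1' pos[OF vD] by auto
      have "\<exists>i2 z. i < i2 \<and> (i2, y1, z) \<in> D \<and> clash_free D (insert (i2, y1, z) (S \<union> G))"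
      proof (rule extend_by_second_coordinate[OF D SGF])
        fix i2 j2 k2 assume u: "(i2, j2, k2) \<in> S \<union> G"
        show "y1 \<le> j2 \<or> (i2, y1, k2) \<notin> D" if "i2 \<le> i"
        proof (cases "i2 = i")
          case True
          then have k2: "k2 \<in> Z" and j2: "j2 \<in> Y" using u coordZ coordY by blast+
          have "k < k2 \<or> j < j2" using u Sk Glevel True by blast
          then show ?thesis using no_corner[OF k2] y1_le[OF j2] True by blast
        next
          case False
          then have "(i2, j2, k2) \<in> S" "i2 < i" using u that Ghigh by fastforce+
          then show ?thesis using y1' unfolding Y_def by blast
        qed
        show "j2 \<noteq> y1" if "i < i2"
          using cv(2)[OF u] that y1' y1D unfolding v by auto
      next
        show "(Suc i, y1, 1) \<in> D"
          using down[OF w0D, of "Suc i" y1 1] \<open>i < i'\<close> y1' pos[OF w0D] by auto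
      qed
      then obtain i2 z where w: "i < i2" "(i2, y1, z) \<in> D" "clash_free D (insert (i2, y1, z) (S \<union> G))"
        by blast
      moreover have "clash D v (i2, y1, z)" using w y1' y1D unfolding v by auto
      ultimately show ?thesis using clash_less cv(2) by blast
    next
      case 2
      have Sk: "k < k2" if "(i, j2, k2) \<in> S" for j2 k2
      proof -
        have "(i, j2, k') \<in> D"
          using down[OF 2(2), of i j2 k'] Slevel[OF that] inD[of "(i, j2, k2)"] that pos[of i j2 k2] pos[OF w0D] by auto
        then show ?thesis using cw0[OF that] 2 \<open>i < i'\<close> unfolding w0_eq by auto
      qed
      note z1' = z1[OF w0Z 2(1)] z1_le[OF w0Z 2(1)]
      have no_corner: "(i, y, z1) \<notin> D" if "y \<in> Y" "j < y" for y
        using False Sk z1' that by blast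
      have z1D: "(i, j, z1) \<in> D" using down[OF 2(2), of i j z1] z1' pos[OF vD] by auto
      have "\<exists>i2 y. i < i2 \<and> (i2, y, z1) \<in> D \<and> clash_free D (insert (i2, y, z1) (S \<union> G))"
      proof (rule extend_by_third_coordinate[OF D SGF])
        fix i2 j2 k2 assume u: "(i2, j2, k2) \<in> S \<union> G"
        show "z1 \<le> k2 \<or> (i2, j2, z1) \<notin> D" if "i2 \<le> i"
        proof (cases "i2 = i")
          case True
          then have k2: "k2 \<in> Z" and j2: "j2 \<in> Y" using u coordZ coordY by blast+
          have "k < k2 \<or> j < j2" using u Sk Glevel True by blast
          then show ?thesis using no_corner[OF j2] z1_le[OF k2] True by blast
        next
          case False
          then have "(i2, j2, k2) \<in> S" "i2 < i" using u that Ghigh by fastforce+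
          then show ?thesis using z1' unfolding Z_def by blast
        qed
        show "k2 \<noteq> z1" if "i < i2"
          using cv(2)[OF u] that z1' z1D unfolding v by auto
      next
        show "(Suc i, 1, z1) \<in> D"
          using down[OF w0D, of "Suc i" 1 z1] \<open>i < i'\<close> z1' pos[OF w0D] by auto
      qed
      then obtain i2 y where w: "i < i2" "(i2, y, z1) \<in> D" "clash_free D (insert (i2, y, z1) (S \<union> G))"
        by blast
      moreover have "clash D v (i2, y, z1)" using w z1' z1D unfolding v by auto
      ultimately show ?thesis using clash_less cv(2) by blast
    qed
  qed
qed

section \<open>A monomial without clashes is determined by its content\<close>

abbreviation px :: "point \<Rightarrow> nat" where "px u \<equiv> fst u"
abbreviation py :: "point \<Rightarrow> nat" where "py u \<equiv> fst (snd u)"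
abbreviation pz :: "point \<Rightarrow> nat" where "pz u \<equiv> snd (snd u)"

definition weight :: "point set \<Rightarrow> monomial \<Rightarrow> (point \<Rightarrow> bool) \<Rightarrow> nat" where
  "weight D m P = (\<Sum>u \<in> D. of_bool (P u) * Poly_Mapping.lookup m u)"

text \<open>For monomials in the variables of \<open>D\<close>: they have the same image under the homomorphism
  that sends \<open>T (i, j, k)\<close> to the product of the \<open>i\<close>-th, \<open>j\<close>-th and \<open>k\<close>-th variable of three
  disjoint sets of variables.\<close>

definition same_content :: "point set \<Rightarrow> monomial \<Rightarrow> monomial \<Rightarrow> bool" where
  "same_content D m m' \<longleftrightarrow>
     (\<forall>Q. weight D m (\<lambda>u. Q (px u)) = weight D m' (\<lambda>u. Q (px u))) \<and>
     (\<forall>Q. weight D m (\<lambda>u. Q (py u)) = weight D m' (\<lambda>u. Q (py u))) \<and>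
     (\<forall>Q. weight D m (\<lambda>u. Q (pz u)) = weight D m' (\<lambda>u. Q (pz u)))"

lemma weight_add: "weight D (m + n) P = weight D m P + weight D n P"
  unfolding weight_def by (simp add: lookup_add sum.distrib algebra_simps)

lemma weight_single:
  "finite D \<Longrightarrow> u \<in> D \<Longrightarrow> weight D (Poly_Mapping.single u c) P = (if P u then c else 0)"
  unfolding weight_def by (simp add: lookup_single when_def if_distrib cong: if_cong)

lemma weight_cong:
  assumes "\<And>u. u \<in> Poly_Mapping.keys m \<Longrightarrow> P u = Q u"
  shows "weight D m P = weight D m Q"
  unfolding weight_def
proof (intro sum.cong refl)
  fix u show "of_bool (P u) * Poly_Mapping.lookup m u = of_bool (Q u) * Poly_Mapping.lookup m u"
    using assms[of u] by (cases "u \<in> Poly_Mapping.keys m") (auto simp: in_keys_iff)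
qed

lemma weight_mono:
  assumes "\<And>u. P u \<Longrightarrow> Q u"
  shows "weight D m P \<le> weight D m Q"
  unfolding weight_def using assms by (intro sum_mono) auto

lemma weight_eq_0:
  assumes "finite D" "Poly_Mapping.keys m \<subseteq> D"
  shows "weight D m P = 0 \<longleftrightarrow> (\<forall>u \<in> Poly_Mapping.keys m. \<not> P u)"
  unfolding weight_def using assms by (auto simp: in_keys_iff subset_iff)

lemma weight_split: "weight D m P = weight D m (\<lambda>u. P u \<and> Q u) + weight D m (\<lambda>u. P u \<and> \<not> Q u)"
  unfolding weight_def sum.distrib[symmetric] by (intro sum.cong) auto

lemma same_content_refl [simp]: "same_content D m m"
  unfolding same_content_def by simp

lemma same_content_sym: "same_content D m m' \<Longrightarrow> same_content D m' m"
  unfolding same_content_def by simp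

lemma same_content_trans: "same_content D a b \<Longrightarrow> same_content D b c \<Longrightarrow> same_content D a c"
  unfolding same_content_def by simp

lemma same_content_add_left [simp]: "same_content D (n + a) (n + b) \<longleftrightarrow> same_content D a b"
  unfolding same_content_def by (simp add: weight_add)

text \<open>Points with both properties and points with neither do not coexist, so the number of the former
  is the excess in the count of \<open>P\<close> and \<open>Q\<close>, if there is any.\<close>

lemma weight_of_crossing:
  assumes "weight D m (\<lambda>u. L u \<and> P u \<and> Q u) = 0 \<or> weight D m (\<lambda>u. L u \<and> \<not> P u \<and> \<not> Q u) = 0"
  shows "weight D m (\<lambda>u. L u \<and> P u \<and> Q u) =
    weight D m (\<lambda>u. L u \<and> P u) + weight D m (\<lambda>u. L u \<and> Q u) - weight D m L"
proof -
  let ?w = "weight D m"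
  have "?w L = ?w (\<lambda>u. L u \<and> P u) + ?w (\<lambda>u. L u \<and> \<not> P u)"
    by (rule weight_split)
  moreover have "?w (\<lambda>u. L u \<and> P u) = ?w (\<lambda>u. L u \<and> P u \<and> Q u) + ?w (\<lambda>u. L u \<and> P u \<and> \<not> Q u)"
    using weight_split[of D m "\<lambda>u. L u \<and> P u" Q] by (simp add: conj_assoc)
  moreover have "?w (\<lambda>u. L u \<and> \<not> P u) = ?w (\<lambda>u. L u \<and> \<not> P u \<and> Q u) + ?w (\<lambda>u. L u \<and> \<not> P u \<and> \<not> Q u)"
    using weight_split[of D m "\<lambda>u. L u \<and> \<not> P u" Q] by (simp add: conj_assoc)
  moreover have "?w (\<lambda>u. L u \<and> Q u) = ?w (\<lambda>u. L u \<and> P u \<and> Q u) + ?w (\<lambda>u. L u \<and> \<not> P u \<and> Q u)"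
    using weight_split[of D m "\<lambda>u. L u \<and> Q u" P] by (simp add: conj_ac)
  ultimately show ?thesis using assms by linarith
qed

lemma weight_point_from_quadrants:
  fixes R D f
  defines "f \<equiv> \<lambda>m a b. weight D m (\<lambda>u. R u \<and> a < py u \<and> b < pz u)"
  assumes "f m j k = f m' j k" "f m (j - 1) k = f m' (j - 1) k" "f m j (k - 1) = f m' j (k - 1)"
    "f m (j - 1) (k - 1) = f m' (j - 1) (k - 1)" "1 \<le> j" "1 \<le> k"
  shows "weight D m (\<lambda>u. R u \<and> py u = j \<and> pz u = k) = weight D m' (\<lambda>u. R u \<and> py u = j \<and> pz u = k)"
proof -
  have "weight D n (\<lambda>u. R u \<and> py u = j \<and> pz u = k) + f n j (k - 1) + f n (j - 1) k
      = f n (j - 1) (k - 1) + f n j k" for n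
    unfolding f_def weight_def sum.distrib[symmetric]
  proof (intro sum.cong refl)
    fix u
    have "j - 1 < py u \<longleftrightarrow> j < py u \<or> py u = j" "k - 1 < pz u \<longleftrightarrow> k < pz u \<or> pz u = k"
      using \<open>1 \<le> j\<close> \<open>1 \<le> k\<close> by auto
    then show "of_bool (R u \<and> py u = j \<and> pz u = k) * Poly_Mapping.lookup n u +
        of_bool (R u \<and> j < py u \<and> k - 1 < pz u) * Poly_Mapping.lookup n u +
        of_bool (R u \<and> j - 1 < py u \<and> k < pz u) * Poly_Mapping.lookup n u =
        of_bool (R u \<and> j - 1 < py u \<and> k - 1 < pz u) * Poly_Mapping.lookup n u +
        of_bool (R u \<and> j < py u \<and> k < pz u) * Poly_Mapping.lookup n u"
      by auto
  qed
  from this[of m] this[of m'] show ?thesis using assms by linarith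
qed

text \<open>The projection property enters the argument only in this form: level \<open>i\<close> contains the smallest
  rectangle around all higher levels.\<close>

definition boxed :: "point set \<Rightarrow> nat \<Rightarrow> nat \<Rightarrow> nat \<Rightarrow> bool" where
  "boxed D i p q \<longleftrightarrow>
     (\<forall>u \<in> D. i < px u \<longrightarrow> py u \<le> p \<and> pz u \<le> q) \<and>
     (\<forall>j k. 1 \<le> j \<and> j \<le> p \<and> 1 \<le> k \<and> k \<le> q \<longrightarrow> (i, j, k) \<in> D)"

lemma boxed_exists:
  assumes D: "ferrers_diagram D" and "projection_property D" and "1 \<le> i"
  shows "\<exists>p q. boxed D i p q"
proof (cases "(Suc i, 1, 1) \<in> D")
  case False
  have "\<not> i < px u" if "u \<in> D" for u
    using ferrers_down[OF D, of "px u" "py u" "pz u" "Suc i" 1 1] ferrers_pos[OF D, of "px u" "py u" "pz u"]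
      that False by auto
  then have "boxed D i 0 0" unfolding boxed_def by auto
  then show ?thesis by blast
next
  case True
  have finD: "finite D" using D unfolding ferrers_diagram_def by simp
  let ?J = "{j. (Suc i, j, 1) \<in> D}" and ?K = "{k. (Suc i, 1, k) \<in> D}"
  have "?J \<subseteq> py ` D" "?K \<subseteq> pz ` D" by force+
  then have fin: "finite ?J" "finite ?K" using finD finite_subset by blast+
  have "{1..Suc i} \<subseteq> (\<lambda>(i, j, k). i) ` D"
  proof
    fix a assume "a \<in> {1..Suc i}"
    then have "(a, 1, 1) \<in> D" using ferrers_down[OF D True] by simp
    then show "a \<in> (\<lambda>(i, j, k). i) ` D" by force
  qed
  then have "card {1..Suc i} \<le> num_x D"
    unfolding num_x_def using finD by (intro card_mono) auto
  then have corner: "(i, Max ?J, Max ?K) \<in> D"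
    using assms unfolding projection_property_def by (auto dest: spec[of _ "Suc i"])
  have "py u \<le> Max ?J \<and> pz u \<le> Max ?K" if "u \<in> D" "i < px u" for u
  proof -
    have "(px u, py u, pz u) \<in> D" using that by simp
    note * = ferrers_down[OF D this] ferrers_pos[OF D this]
    have "py u \<in> ?J" "pz u \<in> ?K" using * that by auto
    then show ?thesis using fin by simp
  qed
  moreover have "(i, j, k) \<in> D" if "1 \<le> j" "j \<le> Max ?J" "1 \<le> k" "k \<le> Max ?K" for j k
    using ferrers_down[OF D corner, of i j k] that \<open>1 \<le> i\<close> by simp
  ultimately have "boxed D i (Max ?J) (Max ?K)" unfolding boxed_def by blast
  then show ?thesis by blast
qed

lemma boxed_high:
  assumes "boxed D i p q" "u \<in> D" "i < px u"
  shows "py u \<le> p" "pz u \<le> q"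
  using assms unfolding boxed_def by blast+

lemma clash_free_level:
  assumes "clash_free D K" "u \<in> K" "v \<in> K" "px u = px v"
  shows "\<not> (py u < py v \<and> pz u < pz v)"
  using clash_freeD[OF assms(1-3)] assms(4) by (cases u; cases v) auto

text \<open>A larger coordinate of \<open>v\<close> could be switched into \<open>u\<close>, as the result would still lie in the box.\<close>

lemma clash_free_box_dominates:
  assumes D: "ferrers_diagram D" and "boxed D i p q" "clash_free D K"
    and u: "u \<in> K" "px u = i" "py u \<le> p" "pz u \<le> q" and v: "v \<in> K" "i < px v"
  shows "py v \<le> py u" "pz v \<le> pz u"
proof -
  have D': "(px u, py u, pz u) \<in> D" "(px v, py v, pz v) \<in> D"
    using assms unfolding clash_free_def by auto
  note pos = D'[THEN ferrers_pos[OF D]]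
  have "(i, py v, pz u) \<in> D" "(i, py u, pz v) \<in> D"
    using assms(2) u boxed_high[OF assms(2) D'(2)] v pos unfolding boxed_def by simp_all
  moreover have "\<not> clash D u v" using clash_freeD[OF assms(3) u(1) v(1)] .
  ultimately show "py v \<le> py u" "pz v \<le> pz u" using u v by (cases u; cases v; force)+
qed

text \<open>The number of points of a reduced monomial in the quadrants \<open>{(j, k). a < j \<and> b < k}\<close> beyond the
  box is determined by the content: all points with second coordinate above \<open>a\<close> or third one above \<open>b\<close>
  are on level \<open>i\<close>, which cannot meet both the quadrant and its opposite.\<close>

lemma weight_outside_box:
  assumes fin: "finite D" and bx: "boxed D i p q" and cf: "clash_free D (Poly_Mapping.keys m)"
    and low: "\<And>u. u \<in> Poly_Mapping.keys m \<Longrightarrow> i \<le> px u" and "p \<le> a" "q \<le> b"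
  shows "weight D m (\<lambda>u. a < py u \<and> b < pz u) =
    weight D m (\<lambda>u. a < py u) + weight D m (\<lambda>u. b < pz u) - weight D m (\<lambda>u. px u = i)"
proof -
  let ?w = "weight D m" and ?L = "\<lambda>u. px u = i"
  have KD: "Poly_Mapping.keys m \<subseteq> D" using cf unfolding clash_free_def by simp
  have level: "px u = i" if "u \<in> Poly_Mapping.keys m" "a < py u \<or> b < pz u" for u
  proof -
    have "\<not> i < px u" using boxed_high[OF bx, of u] that KD assms(5,6) by fastforce
    then show ?thesis using low[OF that(1)] by simp
  qed
  have "False" if "u \<in> Poly_Mapping.keys m" "px u = i" "a < py u" "b < pz u"
      "v \<in> Poly_Mapping.keys m" "px v = i" "\<not> a < py v" "\<not> b < pz v" for u v
    using clash_free_level[OF cf that(5,1)] that by simp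
  then have "?w (\<lambda>u. ?L u \<and> a < py u \<and> b < pz u) = 0 \<or> ?w (\<lambda>u. ?L u \<and> \<not> a < py u \<and> \<not> b < pz u) = 0"
    unfolding weight_eq_0[OF fin KD]
    by blast
  then have "?w (\<lambda>u. ?L u \<and> a < py u \<and> b < pz u) =
      ?w (\<lambda>u. ?L u \<and> a < py u) + ?w (\<lambda>u. ?L u \<and> b < pz u) - ?w ?L"
    by (rule weight_of_crossing)
  moreover have "?w (\<lambda>u. ?L u \<and> a < py u \<and> b < pz u) = ?w (\<lambda>u. a < py u \<and> b < pz u)"
    "?w (\<lambda>u. ?L u \<and> a < py u) = ?w (\<lambda>u. a < py u)" "?w (\<lambda>u. ?L u \<and> b < pz u) = ?w (\<lambda>u. b < pz u)"
    by (rule weight_cong; use level in blast)+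
  ultimately show ?thesis by simp
qed

text \<open>If level \<open>i\<close> does not meet the quadrant opposite to the box, the points inside the box
  take the largest second coordinates that are at most \<open>p\<close>, and the largest third ones that are at
  most \<open>q\<close>.\<close>

lemma weight_inside_box:
  assumes D: "ferrers_diagram D" and bx: "boxed D i p q" and cf: "clash_free D (Poly_Mapping.keys m)"
    and low: "\<And>u. u \<in> Poly_Mapping.keys m \<Longrightarrow> i \<le> px u"
    and none: "weight D m (\<lambda>u. p < py u \<and> q < pz u) = 0"
  defines "R \<equiv> \<lambda>u. px u = i \<and> py u \<le> p \<and> pz u \<le> q"
  shows "weight D m R = weight D m (\<lambda>u. px u = i) - weight D m (\<lambda>u. p < py u) - weight D m (\<lambda>u. q < pz u)"
    and "weight D m (\<lambda>u. R u \<and> a < py u \<and> b < pz u) =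
      min (weight D m R) (weight D m (\<lambda>u. a < py u \<and> py u \<le> p)) +
      min (weight D m R) (weight D m (\<lambda>u. b < pz u \<and> pz u \<le> q)) - weight D m R"
proof -
  let ?w = "weight D m" and ?L = "\<lambda>u. px u = i"
  have fin: "finite D" using D unfolding ferrers_diagram_def by simp
  have KD: "Poly_Mapping.keys m \<subseteq> D" using cf unfolding clash_free_def by simp
  have level: "px u = i" if "u \<in> Poly_Mapping.keys m" "p < py u \<or> q < pz u" for u
  proof -
    have "\<not> i < px u" using boxed_high[OF bx, of u] that KD by fastforce
    then show ?thesis using low[OF that(1)] by simp
  qed
  have out: "\<not> (p < py u \<and> q < pz u)" if "u \<in> Poly_Mapping.keys m" for u
    using none weight_eq_0[OF fin KD] that by simp
  have "?w ?L = ?w (\<lambda>u. ?L u \<and> p < py u) + ?w (\<lambda>u. ?L u \<and> \<not> p < py u)"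
    by (rule weight_split)
  moreover have "?w (\<lambda>u. ?L u \<and> \<not> p < py u) = ?w (\<lambda>u. (?L u \<and> \<not> p < py u) \<and> q < pz u) +
      ?w (\<lambda>u. (?L u \<and> \<not> p < py u) \<and> \<not> q < pz u)"
    by (rule weight_split)
  moreover have "?w (\<lambda>u. ?L u \<and> p < py u) = ?w (\<lambda>u. p < py u)"
    by (rule weight_cong) (use level in blast)
  moreover have "?w (\<lambda>u. (?L u \<and> \<not> p < py u) \<and> q < pz u) = ?w (\<lambda>u. q < pz u)"
    by (rule weight_cong) (use level out in blast)
  moreover have "?w (\<lambda>u. (?L u \<and> \<not> p < py u) \<and> \<not> q < pz u) = ?w R"
    unfolding R_def by (rule weight_cong) auto
  ultimately show "?w R = ?w ?L - ?w (\<lambda>u. p < py u) - ?w (\<lambda>u. q < pz u)" by linarith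
  have y: "?w (\<lambda>u. R u \<and> a < py u) = min (?w R) (?w (\<lambda>u. a < py u \<and> py u \<le> p))"
  proof (cases "\<exists>u \<in> Poly_Mapping.keys m. R u \<and> py u \<le> a")
    case True
    then obtain u where u: "u \<in> Poly_Mapping.keys m" "px u = i" "py u \<le> p" "pz u \<le> q" "py u \<le> a"
      unfolding R_def by blast
    have "R v" if v: "v \<in> Poly_Mapping.keys m" "a < py v" "py v \<le> p" for v
    proof -
      have "\<not> i < px v" using clash_free_box_dominates[OF D bx cf u(1-4) v(1)] u(5) v(2) by linarith
      then have "px v = i" using low[OF v(1)] by simp
      moreover have "\<not> q < pz v" using clash_free_level[OF cf u(1) v(1)] u v(2) calculation by auto
      ultimately show ?thesis unfolding R_def using v by simp
    qed
    then have "?w (\<lambda>u. R u \<and> a < py u) = ?w (\<lambda>u. a < py u \<and> py u \<le> p)"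
      by (intro weight_cong) (auto simp: R_def)
    moreover have "?w (\<lambda>u. R u \<and> a < py u) \<le> ?w R" by (rule weight_mono) simp
    ultimately show ?thesis by simp
  next
    case False
    then have "?w (\<lambda>u. R u \<and> a < py u) = ?w R" by (intro weight_cong) (auto simp: not_le)
    moreover have "?w (\<lambda>u. R u \<and> a < py u) \<le> ?w (\<lambda>u. a < py u \<and> py u \<le> p)"
      unfolding R_def by (rule weight_mono) simp
    ultimately show ?thesis by simp
  qed
  have z: "?w (\<lambda>u. R u \<and> b < pz u) = min (?w R) (?w (\<lambda>u. b < pz u \<and> pz u \<le> q))"
  proof (cases "\<exists>u \<in> Poly_Mapping.keys m. R u \<and> pz u \<le> b")
    case True
    then obtain u where u: "u \<in> Poly_Mapping.keys m" "px u = i" "py u \<le> p" "pz u \<le> q" "pz u \<le> b"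
      unfolding R_def by blast
    have "R v" if v: "v \<in> Poly_Mapping.keys m" "b < pz v" "pz v \<le> q" for v
    proof -
      have "\<not> i < px v" using clash_free_box_dominates[OF D bx cf u(1-4) v(1)] u(5) v(2) by linarith
      then have "px v = i" using low[OF v(1)] by simp
      moreover have "\<not> p < py v" using clash_free_level[OF cf u(1) v(1)] u v(2) calculation by auto
      ultimately show ?thesis unfolding R_def using v by simp
    qed
    then have "?w (\<lambda>u. R u \<and> b < pz u) = ?w (\<lambda>u. b < pz u \<and> pz u \<le> q)"
      by (intro weight_cong) (auto simp: R_def)
    moreover have "?w (\<lambda>u. R u \<and> b < pz u) \<le> ?w R" by (rule weight_mono) simp
    ultimately show ?thesis by simp
  next
    case False
    then have "?w (\<lambda>u. R u \<and> b < pz u) = ?w R" by (intro weight_cong) (auto simp: not_le)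
    moreover have "?w (\<lambda>u. R u \<and> b < pz u) \<le> ?w (\<lambda>u. b < pz u \<and> pz u \<le> q)"
      unfolding R_def by (rule weight_mono) simp
    ultimately show ?thesis by simp
  qed
  have "False" if "u \<in> Poly_Mapping.keys m" "px u = i" "a < py u" "b < pz u"
      "v \<in> Poly_Mapping.keys m" "px v = i" "\<not> a < py v" "\<not> b < pz v" for u v
    using clash_free_level[OF cf that(5,1)] that by simp
  then have "?w (\<lambda>u. R u \<and> a < py u \<and> b < pz u) = 0 \<or> ?w (\<lambda>u. R u \<and> \<not> a < py u \<and> \<not> b < pz u) = 0"
    unfolding weight_eq_0[OF fin KD] R_def
    by blast
  then show "?w (\<lambda>u. R u \<and> a < py u \<and> b < pz u) =
      min (?w R) (?w (\<lambda>u. a < py u \<and> py u \<le> p)) + min (?w R) (?w (\<lambda>u. b < pz u \<and> pz u \<le> q)) - ?w R"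
    unfolding y[symmetric] z[symmetric] by (rule weight_of_crossing)
qed

text \<open>If level \<open>i\<close> has neither points in the box nor points beyond it in both directions, the
  coordinates of one of its points can be read off from the two sets of coordinates.\<close>

lemma point_above_box:
  assumes D: "ferrers_diagram D" and bx: "boxed D i p q" and cf: "clash_free D K"
    and low: "\<And>u. u \<in> K \<Longrightarrow> i \<le> px u"
    and mixed: "\<And>u. u \<in> K \<Longrightarrow> px u = i \<Longrightarrow> py u \<le> p \<and> q < pz u \<or> p < py u \<and> pz u \<le> q"
    and ex: "\<exists>u \<in> K. q < pz u"
  defines "z \<equiv> Min {c \<in> pz ` K. q < c}"
  shows "(i, Max {b \<in> py ` K. b \<le> p \<and> (i, b, z) \<in> D}, z) \<in> K"
proof -
  have KD: "K \<subseteq> D" using cf unfolding clash_free_def by simp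
  have fin: "finite K" using KD D finite_subset unfolding ferrers_diagram_def by blast
  have level: "px u = i" if "u \<in> K" "q < pz u" for u
    using boxed_high[OF bx, of u] low[OF that(1)] that KD by fastforce
  have "z \<in> {c \<in> pz ` K. q < c}" unfolding z_def using fin ex by (intro Min_in) auto
  then obtain u where u: "u \<in> K" "pz u = z" "q < z" by blast
  have zmin: "z \<le> pz v" if "v \<in> K" "q < pz v" for v
    unfolding z_def using fin that by (intro Min_le) auto
  let ?J = "{j. (i, j, z) \<in> K}"
  have "?J \<subseteq> py ` K" by force
  then have finJ: "finite ?J" using fin finite_subset by blast
  have "px u = i" using level u by simp
  then have "(i, py u, z) \<in> K" using u by (metis prod.collapse)
  then have "Max ?J \<in> ?J" using finJ by (intro Max_in) auto
  then have j: "(i, Max ?J, z) \<in> K" by simp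
  have "Max {b \<in> py ` K. b \<le> p \<and> (i, b, z) \<in> D} = Max ?J"
  proof (rule Max_eqI)
    show "finite {b \<in> py ` K. b \<le> p \<and> (i, b, z) \<in> D}" using fin by simp
    have "Max ?J \<in> py ` K" using j by force
    then show "Max ?J \<in> {b \<in> py ` K. b \<le> p \<and> (i, b, z) \<in> D}"
      using j KD mixed[OF j] u by auto
    fix b assume "b \<in> {b \<in> py ` K. b \<le> p \<and> (i, b, z) \<in> D}"
    then obtain v where v: "v \<in> K" "py v = b" "b \<le> p" "(i, b, z) \<in> D" by blast
    show "b \<le> Max ?J"
    proof (rule ccontr)
      assume less: "\<not> b \<le> Max ?J"
      have ncl: "\<not> clash D (i, Max ?J, z) (px v, py v, pz v)" using clash_freeD[OF cf j v(1)] by simp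
      then have "px v = i" using low[OF v(1)] less v by auto
      then have "q < pz v" using mixed[OF v(1)] v by auto
      then have "z \<le> pz v" using zmin v by blast
      moreover have "pz v \<noteq> z"
      proof
        assume "pz v = z"
        then have "b \<in> ?J" using v \<open>px v = i\<close> by (metis mem_Collect_eq prod.collapse)
        then show False using finJ less by simp
      qed
      ultimately show False using ncl less v \<open>px v = i\<close> by auto
    qed
  qed
  then show ?thesis using j by simp
qed

lemma boxed_swap23:
  assumes "boxed D i p q" shows "boxed (swap23 ` D) i q p"
proof -
  have "py u \<le> q \<and> pz u \<le> p" if "u \<in> swap23 ` D" "i < px u" for u
  proof -
    obtain a b c where u: "u = (a, b, c)" by (cases u)
    have "(a, c, b) \<in> D" using that u by simp
    then show ?thesis using boxed_high[OF assms, of "(a, c, b)"] that u by simp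
  qed
  then show ?thesis using assms unfolding boxed_def by auto
qed

lemma common_point_beside_box:
  assumes D: "ferrers_diagram D" and bx: "boxed D i p q"
    and cf: "clash_free D K" "clash_free D K'"
    and low: "\<And>u. u \<in> K \<union> K' \<Longrightarrow> i \<le> px u"
    and mixed: "\<And>u. u \<in> K \<union> K' \<Longrightarrow> px u = i \<Longrightarrow> py u \<le> p \<and> q < pz u \<or> p < py u \<and> pz u \<le> q"
    and coords: "py ` K = py ` K'" "pz ` K = pz ` K'" and ex: "\<exists>u \<in> K. px u = i"
  shows "K \<inter> K' \<noteq> {}"
proof -
  obtain u where u: "u \<in> K" "px u = i" using ex by blast
  show ?thesis
  proof (cases "q < pz u")
    case True
    have "pz u \<in> pz ` K'" using imageI[OF u(1), of pz] unfolding coords .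
    then obtain u' where u': "pz u = pz u'" "u' \<in> K'" by (rule imageE)
    have "q < pz u'" using True u'(1) by simp
    then have ex: "\<exists>u \<in> K'. q < pz u" using u'(2) by (rule bexI[of _ u'])
    have ex': "\<exists>u \<in> K. q < pz u" using True u(1) by (rule bexI[of _ u])
    have low': "\<And>v. v \<in> K \<Longrightarrow> i \<le> px v" "\<And>v. v \<in> K' \<Longrightarrow> i \<le> px v"
      using low by simp_all
    have mixed': "\<And>v. v \<in> K \<Longrightarrow> px v = i \<Longrightarrow> py v \<le> p \<and> q < pz v \<or> p < py v \<and> pz v \<le> q"
      "\<And>v. v \<in> K' \<Longrightarrow> px v = i \<Longrightarrow> py v \<le> p \<and> q < pz v \<or> p < py v \<and> pz v \<le> q"
      using mixed by simp_all
    note above = point_above_box[OF D bx cf(1) low'(1) mixed'(1) ex']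
      point_above_box[OF D bx cf(2) low'(2) mixed'(2) ex, folded coords]
    show ?thesis
      by (rule ex_in_conv[THEN iffD1], rule exI, rule IntI[OF above])
  next
    case False
    have "py u \<in> py ` K'" using imageI[OF u(1), of py] unfolding coords .
    then obtain u' where u': "py u = py u'" "u' \<in> K'" by (rule imageE)
    have "p < py u" using False u mixed[of u] by simp
    have px: "px (swap23 v) = px v" and py: "py (swap23 v) = pz v" and pz: "pz (swap23 v) = py v" for v
      by (cases v, simp)+
    have "swap23 u \<in> swap23 ` K" "swap23 u' \<in> swap23 ` K'" using u u' by simp_all
    moreover have "p < pz (swap23 u)" "p < pz (swap23 u')"
      using u'(1) \<open>p < py u\<close> by (simp_all only: pz)
    ultimately have ex: "\<exists>u \<in> swap23 ` K. p < pz u" "\<exists>u \<in> swap23 ` K'. p < pz u"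
      by - (rule bexI, assumption+)+
    have lowS: "i \<le> px v" if "swap23 v \<in> K \<union> K'" for v
      using low[OF that] by (simp only: px)
    have mixedS: "py v \<le> q \<and> p < pz v \<or> q < py v \<and> pz v \<le> p" if "swap23 v \<in> K \<union> K'" "px v = i" for v
      using mixed[OF that(1)] that(2) unfolding px py pz by blast
    have low': "\<And>v. v \<in> swap23 ` K \<Longrightarrow> i \<le> px v" "\<And>v. v \<in> swap23 ` K' \<Longrightarrow> i \<le> px v"
      using lowS by simp_all
    have mixed': "\<And>v. v \<in> swap23 ` K \<Longrightarrow> px v = i \<Longrightarrow> py v \<le> q \<and> p < pz v \<or> q < py v \<and> pz v \<le> p"
      "\<And>v. v \<in> swap23 ` K' \<Longrightarrow> px v = i \<Longrightarrow> py v \<le> q \<and> p < pz v \<or> q < py v \<and> pz v \<le> p"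
      using mixedS by simp_all
    have coords': "py ` swap23 ` K = py ` swap23 ` K'" "pz ` swap23 ` K = pz ` swap23 ` K'"
      unfolding image_image py pz by (fact coords)+
    note above = point_above_box[OF ferrers_swap23[OF D] boxed_swap23[OF bx]]
    have cf': "clash_free (swap23 ` D) (swap23 ` K)" "clash_free (swap23 ` D) (swap23 ` K')" using cf by auto
    have "\<exists>w. w \<in> swap23 ` K \<inter> swap23 ` K'"
      by (rule exI, rule IntI[OF above[OF cf'(1) low'(1) mixed'(1) ex(1)]
        above[OF cf'(2) low'(2) mixed'(2) ex(2), folded coords']])
    then obtain w where "w \<in> swap23 ` K \<inter> swap23 ` K'" ..
    then have "swap23 w \<in> K \<inter> K'" by simp
    then show ?thesis by (rule ex_in_conv[THEN iffD1, OF exI])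
  qed
qed

text \<open>On the lowest level \<open>i\<close> in the two monomials, which is the same by equality of contents, compare the points beyond the box in both
  directions, then those inside the box, and finally the others.\<close>

lemma reduced_common_point:
  assumes D: "ferrers_diagram D" "projection_property D"
    and cf: "clash_free D (Poly_Mapping.keys m)" "clash_free D (Poly_Mapping.keys m')"
    and same: "same_content D m m'" and "m \<noteq> 0"
  shows "Poly_Mapping.keys m \<inter> Poly_Mapping.keys m' \<noteq> {}"
proof -
  have fin: "finite D" using D unfolding ferrers_diagram_def by simp
  have KD: "Poly_Mapping.keys m \<subseteq> D" "Poly_Mapping.keys m' \<subseteq> D"
    using cf unfolding clash_free_def by auto
  have sx: "weight D m (\<lambda>u. Q (px u)) = weight D m' (\<lambda>u. Q (px u))"
    and sy: "weight D m (\<lambda>u. Q (py u)) = weight D m' (\<lambda>u. Q (py u))"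
    and sz: "weight D m (\<lambda>u. Q (pz u)) = weight D m' (\<lambda>u. Q (pz u))" for Q
    using same unfolding same_content_def by blast+
  note zero = weight_eq_0[OF fin KD(1)] weight_eq_0[OF fin KD(2)]
  define i where "i = Min (px ` Poly_Mapping.keys m)"
  have "Poly_Mapping.keys m \<noteq> {}"
    using \<open>m \<noteq> 0\<close> by (metis ex_in_conv in_keys_iff lookup_zero poly_mapping_eqI)
  then have "i \<in> px ` Poly_Mapping.keys m" unfolding i_def by (intro Min_in) auto
  then obtain u0 where u0: "u0 \<in> Poly_Mapping.keys m" "px u0 = i" by blast
  have low1: "i \<le> px u" if "u \<in> Poly_Mapping.keys m" for u
    unfolding i_def using that by (intro Min_le) auto
  then have "weight D m (\<lambda>u. px u < i) = 0" unfolding zero by (auto simp: not_less)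
  then have low2: "i \<le> px u" if "u \<in> Poly_Mapping.keys m'" for u
    using that unfolding sx[of "\<lambda>a. a < i"] zero by (auto simp: not_less)
  have "(px u0, py u0, pz u0) \<in> D" using u0 KD by auto
  then have "1 \<le> i" using ferrers_pos[OF D(1)] u0 by blast
  then obtain p q where bx: "boxed D i p q" using boxed_exists D by blast
  have common: ?thesis if R: "\<And>v. v \<in> Poly_Mapping.keys m' \<Longrightarrow> R v \<Longrightarrow> px v = i"
      and u: "u \<in> Poly_Mapping.keys m" "R u" "px u = i"
      and eq: "weight D m (\<lambda>v. R v \<and> py v = py u \<and> pz v = pz u) =
        weight D m' (\<lambda>v. R v \<and> py v = py u \<and> pz v = pz u)" for R u
  proof -
    have "weight D m (\<lambda>v. R v \<and> py v = py u \<and> pz v = pz u) \<noteq> 0" unfolding zero using u by auto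
    then obtain v where v: "v \<in> Poly_Mapping.keys m'" "R v" "py v = py u" "pz v = pz u"
      unfolding eq zero by blast
    then have "v = u" using R[OF v(1,2)] u(3) by (simp add: prod_eq_iff)
    then show ?thesis using u v by blast
  qed
  have upos: "1 \<le> py u" "1 \<le> pz u" if "u \<in> Poly_Mapping.keys m" for u
    using ferrers_pos[OF D(1), of "px u" "py u" "pz u"] that KD by auto
  have beyond: "weight D m (\<lambda>u. a < py u \<and> b < pz u) = weight D m' (\<lambda>u. a < py u \<and> b < pz u)"
    if "p \<le> a" "q \<le> b" for a b
    using weight_outside_box[OF fin bx cf(1) low1 that] weight_outside_box[OF fin bx cf(2) low2 that]
      sx[of "\<lambda>c. c = i"] sy[of "\<lambda>c. a < c"] sz[of "\<lambda>c. b < c"] by linarith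
  show ?thesis
  proof (cases "weight D m (\<lambda>u. p < py u \<and> q < pz u) = 0")
    case False
    then obtain u where u: "u \<in> Poly_Mapping.keys m" "p < py u" "q < pz u" unfolding zero by blast
    show ?thesis
    proof (rule common[of "\<lambda>u. p < py u" u])
      show "px v = i" if "v \<in> Poly_Mapping.keys m'" "p < py v" for v
        using boxed_high(1)[OF bx, of v] low2[OF that(1)] KD that by fastforce
      show "px u = i"
        using boxed_high(1)[OF bx, of u] low1[OF u(1)] KD u by fastforce
      have *: "weight D n (\<lambda>u. p < py u \<and> a < py u \<and> b < pz u) = weight D n (\<lambda>u. a < py u \<and> b < pz u)"
        if "p \<le> a" for n a b
        by (rule weight_cong) (use that in auto)
      show "weight D m (\<lambda>v. p < py v \<and> py v = py u \<and> pz v = pz u) =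
          weight D m' (\<lambda>v. p < py v \<and> py v = py u \<and> pz v = pz u)"
        by (rule weight_point_from_quadrants) (use u upos[OF u(1)] in \<open>auto simp: * beyond\<close>)
    qed (use u in auto)
  next
    case True
    then have True': "weight D m' (\<lambda>u. p < py u \<and> q < pz u) = 0" using beyond by simp
    let ?R = "\<lambda>u. px u = i \<and> py u \<le> p \<and> pz u \<le> q"
    note inside = weight_inside_box[OF D(1) bx cf(1) low1 True] weight_inside_box[OF D(1) bx cf(2) low2 True']
    have R: "weight D m ?R = weight D m' ?R"
      using inside(1,3) sx[of "\<lambda>c. c = i"] sy[of "\<lambda>c. p < c"] sz[of "\<lambda>c. q < c"] by linarith
    have RR: "weight D m (\<lambda>u. ?R u \<and> a < py u \<and> b < pz u) = weight D m' (\<lambda>u. ?R u \<and> a < py u \<and> b < pz u)"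
      for a b
      using inside(2)[of a b] inside(4)[of a b] R
        sy[of "\<lambda>c. a < c \<and> c \<le> p"] sz[of "\<lambda>c. b < c \<and> c \<le> q"] by linarith
    show ?thesis
    proof (cases "weight D m ?R = 0")
      case False
      then obtain u where u: "u \<in> Poly_Mapping.keys m" "?R u" unfolding zero by blast
      show ?thesis
      proof (rule common[of ?R u])
        show "weight D m (\<lambda>v. ?R v \<and> py v = py u \<and> pz v = pz u) =
            weight D m' (\<lambda>v. ?R v \<and> py v = py u \<and> pz v = pz u)"
          by (rule weight_point_from_quadrants[where R = ?R]) (rule RR upos[OF u(1)])+
      qed (use u in auto)
    next
      case R0: True
      have mixed: "py u \<le> p \<and> q < pz u \<or> p < py u \<and> pz u \<le> q"
        if "u \<in> Poly_Mapping.keys m \<union> Poly_Mapping.keys m'" "px u = i" for u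
      proof -
        have "\<not> ?R u" using that(1) R0 R0[unfolded R] unfolding zero by blast
        moreover have "\<not> (p < py u \<and> q < pz u)" using that(1) True True' unfolding zero by blast
        ultimately show ?thesis using that(2) by auto
      qed
      have coord: "f ` Poly_Mapping.keys m = f ` Poly_Mapping.keys m'"
        if eq: "\<And>Q. weight D m (\<lambda>u. Q (f u)) = weight D m' (\<lambda>u. Q (f u))" for f :: "point \<Rightarrow> nat"
      proof -
        have "c \<notin> f ` Poly_Mapping.keys m \<longleftrightarrow> c \<notin> f ` Poly_Mapping.keys m'" for c
          using zero(1)[of "\<lambda>u. f u = c"] zero(2)[of "\<lambda>u. f u = c"] eq[of "\<lambda>a. a = c"]
          unfolding image_iff by fastforce
        then have "c \<in> f ` Poly_Mapping.keys m \<longleftrightarrow> c \<in> f ` Poly_Mapping.keys m'" for c by blast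
        then show ?thesis by (rule Set.set_eqI)
      qed
      show ?thesis
        by (rule common_point_beside_box[OF D(1) bx cf _ mixed coord[OF sy] coord[OF sz]])
          (use low1 low2 u0 in auto)
    qed
  qed
qed

theorem reduced_monomial_unique:
  assumes D: "ferrers_diagram D" "projection_property D"
    and "clash_free D (Poly_Mapping.keys m)" "clash_free D (Poly_Mapping.keys m')"
    and "same_content D m m'"
  shows "m = m'"
  using assms(3-5)
proof (induction "weight D m (\<lambda>_. True)" arbitrary: m m' rule: less_induct)
  case less
  have fin: "finite D" using D unfolding ferrers_diagram_def by simp
  show ?case
  proof (cases "m = 0 \<or> m' = 0")
    case True
    have KD: "Poly_Mapping.keys m \<subseteq> D" "Poly_Mapping.keys m' \<subseteq> D"
      using less.prems unfolding clash_free_def by auto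
    have "weight D m (\<lambda>u. True) = weight D m' (\<lambda>u. True)"
      using less.prems(3) unfolding same_content_def by (elim conjE) (drule spec[of _ "\<lambda>_. True"], simp)
    moreover have "weight D 0 (\<lambda>u. True) = 0" unfolding weight_def by simp
    moreover have "n = 0" if "Poly_Mapping.keys n \<subseteq> D" "weight D n (\<lambda>_. True) = 0" for n
      using that weight_eq_0[OF fin that(1)] by (metis ex_in_conv in_keys_iff lookup_zero poly_mapping_eqI)
    ultimately show ?thesis using True KD by metis
  next
    case False
    then obtain u where u: "u \<in> Poly_Mapping.keys m" "u \<in> Poly_Mapping.keys m'"
      using reduced_common_point[OF D less.prems] by blast
    let ?s = "Poly_Mapping.single u 1 :: monomial"
    have split: "n = ?s + (n - ?s)" if "u \<in> Poly_Mapping.keys n" for n :: monomial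
      using that by (intro poly_mapping_eqI) (auto simp: lookup_add lookup_minus lookup_single when_def in_keys_iff)
    have sub: "clash_free D (Poly_Mapping.keys (n - ?s))" if "clash_free D (Poly_Mapping.keys n)" for n :: monomial
      using that by (rule clash_free_subset) (auto simp: in_keys_iff lookup_minus)
    have "u \<in> D" using u less.prems unfolding clash_free_def by blast
    have "m - ?s = m' - ?s"
    proof (rule less.hyps)
      have "weight D m (\<lambda>_. True) = 1 + weight D (m - ?s) (\<lambda>_. True)"
        using weight_add[of D ?s "m - ?s"] split[OF u(1)] weight_single[OF fin \<open>u \<in> D\<close>] by metis
      then show "weight D (m - ?s) (\<lambda>_. True) < weight D m (\<lambda>_. True)" by simp
      show "same_content D (m - ?s) (m' - ?s)"
        using less.prems(3) same_content_add_left split[OF u(1)] split[OF u(2)] by metis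
    qed (use sub less.prems in auto)
    then show ?thesis using split[OF u(1)] split[OF u(2)] by metis
  qed
qed

section \<open>Normal forms of monomials\<close>

abbreviation var :: "point \<Rightarrow> monomial" where
  "var u \<equiv> Poly_Mapping.single u 1"

definition minors :: "point set \<Rightarrow> 'k::comm_ring_1 tpoly set" where
  "minors D = (\<Union>u \<in> D. \<Union>v \<in> D. {minor_x D u v, minor_y D u v, minor_z D u v})"

lemma T_mult_T: "T u * T v = (Poly_Mapping.single (var u + var v) 1 :: 'k::comm_ring_1 tpoly)"
  unfolding T_def by (simp add: mult_single)

lemma same_content_pair:
  assumes "finite D" "u \<in> D" "v \<in> D" "a \<in> D" "b \<in> D"
    and "px a = px u \<and> px b = px v \<or> px a = px v \<and> px b = px u"
    and "py a = py u \<and> py b = py v \<or> py a = py v \<and> py b = py u"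
    and "pz a = pz u \<and> pz b = pz v \<or> pz a = pz v \<and> pz b = pz u"
  shows "same_content D (var u + var v) (var a + var b)"
proof -
  have w: "weight D (var c + var d) P = of_bool (P c) + of_bool (P d)" if "c \<in> D" "d \<in> D" for c d P
    using that assms(1) by (simp add: weight_add weight_single)
  show ?thesis
    unfolding same_content_def w[OF assms(2,3)] w[OF assms(4,5)]
  proof (intro conjI allI)
    fix Q :: "nat \<Rightarrow> bool"
    show "of_bool (Q (px u)) + of_bool (Q (px v)) = (of_bool (Q (px a)) + of_bool (Q (px b)) :: nat)"
      using assms(6) by (elim disjE conjE) simp_all
    show "of_bool (Q (py u)) + of_bool (Q (py v)) = (of_bool (Q (py a)) + of_bool (Q (py b)) :: nat)"
      using assms(7) by (elim disjE conjE) simp_all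
    show "of_bool (Q (pz u)) + of_bool (Q (pz v)) = (of_bool (Q (pz a)) + of_bool (Q (pz b)) :: nat)"
      using assms(8) by (elim disjE conjE) simp_all
  qed
qed

lemma less_monomialI:
  fixes m n :: monomial
  assumes "Poly_Mapping.lookup m u < Poly_Mapping.lookup n u"
    "\<And>v. v < u \<Longrightarrow> Poly_Mapping.lookup m v = Poly_Mapping.lookup n v"
  shows "m < n"
  unfolding less_poly_mapping.rep_eq less_fun_def
  by (intro exI[of _ u] conjI allI impI assms)

text \<open>The minor that switches the offending coordinates replaces the product of two clashing points
  by a smaller monomial.\<close>

lemma clash_move:
  assumes D: "ferrers_diagram D" and uv: "u \<in> D" "v \<in> D" "clash D u v"
  shows "\<exists>u' \<in> D. \<exists>v' \<in> D. same_content D (var u + var v) (var u' + var v') \<and>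
    var u' + var v' < var u + var v \<and> (T u * T v - T u' * T v' :: 'k::comm_ring_1 tpoly) \<in> minors D"
proof -
  have fin: "finite D" using D unfolding ferrers_diagram_def by simp
  obtain i1 j1 k1 where u: "u = (i1, j1, k1)" by (cases u)
  obtain i2 j2 k2 where v: "v = (i2, j2, k2)" by (cases v)
  have pos: "1 \<le> i1" "1 \<le> j1" "1 \<le> k1" "1 \<le> i2" "1 \<le> j2" "1 \<le> k2"
    using ferrers_pos[OF D] uv unfolding u v by blast+
  have less: "var u' + var v' < var u + var v" if "u < u'" "u < v'" for u' v'
  proof (rule less_monomialI[of _ u])
    show "Poly_Mapping.lookup (var u' + var v') u < Poly_Mapping.lookup (var u + var v) u"
      using that by (auto simp: lookup_add lookup_single when_def)
    show "Poly_Mapping.lookup (var u' + var v') w = Poly_Mapping.lookup (var u + var v) w" if "w < u" for w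
      using that \<open>u < u'\<close> \<open>u < v'\<close> clash_less[OF uv(3)] by (auto simp: lookup_add lookup_single when_def)
  qed
  consider "i1 < i2" "j1 < j2" "(i1, j2, k1) \<in> D"
    | "(i1, j1) < (i2, j2)" "k1 < k2" "(i1, j1, k2) \<in> D"
    using uv(3) ferrers_down[OF D, of i2 j2 k2 i1 j1 k2] uv pos unfolding u v
    by (auto simp: less_prod_def)
  then show ?thesis
  proof cases
    case 1
    let ?u = "(i1, j2, k1)" and ?v = "(i2, j1, k2)"
    have v': "?v \<in> D" using ferrers_down[OF D, of i2 j2 k2 i2 j1 k2] uv pos 1 unfolding v by simp
    have "minor_y D u v = (T u * T v - T ?u * T ?v :: 'k tpoly)" using 1 v' unfolding u v by simp
    then have "(T u * T v - T ?u * T ?v :: 'k tpoly) \<in> minors D"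
      unfolding minors_def using uv by (metis (no_types, lifting) UN_I insertCI)
    moreover have "same_content D (var u + var v) (var ?u + var ?v)"
      using same_content_pair[OF fin uv(1,2), of ?u ?v] 1 v' unfolding u v by simp
    moreover have "var ?u + var ?v < var u + var v"
      using less[of ?u ?v] 1 unfolding u by (simp add: less_prod_def)
    ultimately show ?thesis using 1 v' by blast
  next
    case 2
    let ?u = "(i1, j1, k2)" and ?v = "(i2, j2, k1)"
    have v': "?v \<in> D" using ferrers_down[OF D, of i2 j2 k2 i2 j2 k1] uv pos 2 unfolding v by simp
    have "minor_z D u v = (T u * T v - T ?u * T ?v :: 'k tpoly)" using 2 v' unfolding u v by simp
    then have "(T u * T v - T ?u * T ?v :: 'k tpoly) \<in> minors D"
      unfolding minors_def using uv by (metis (no_types, lifting) UN_I insertCI)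
    moreover have "same_content D (var u + var v) (var ?u + var ?v)"
      using same_content_pair[OF fin uv(1,2), of ?u ?v] 2 v' unfolding u v by simp
    moreover have "var ?u + var ?v < var u + var v"
      using less[of ?u ?v] 2 unfolding u by (auto simp: less_prod_def)
    ultimately show ?thesis using 2 v' by blast
  qed
qed

lemma keys_add_monomial: "Poly_Mapping.keys (m + n :: monomial) = Poly_Mapping.keys m \<union> Poly_Mapping.keys n"
  by (auto simp: in_keys_iff lookup_add)

lemma finite_fibre:
  assumes "finite D"
  shows "finite {n. Poly_Mapping.keys n \<subseteq> D \<and> same_content D m n}"
proof (rule finite_imageD[where f = Poly_Mapping.lookup])
  let ?b = "weight D m (\<lambda>_. True)"
  have bounded: "Poly_Mapping.lookup n \<in> {f. \<forall>u. (u \<in> D \<longrightarrow> f u \<in> {..?b}) \<and> (u \<notin> D \<longrightarrow> f u = 0)}"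
    if n: "Poly_Mapping.keys n \<subseteq> D" "same_content D m n" for n
  proof -
    have "weight D n (\<lambda>_. True) = ?b"
      using n(2) unfolding same_content_def by (elim conjE) (drule spec[of _ "\<lambda>_. True"], simp)
    moreover have "Poly_Mapping.lookup n u \<le> weight D n (\<lambda>_. True)" if "u \<in> D" for u
      unfolding weight_def using that assms member_le_sum[of u D "Poly_Mapping.lookup n"] by simp
    ultimately show ?thesis using n(1) by (auto simp: in_keys_iff)
  qed
  have "Poly_Mapping.lookup ` {n. Poly_Mapping.keys n \<subseteq> D \<and> same_content D m n} \<subseteq>
      {f. \<forall>u. (u \<in> D \<longrightarrow> f u \<in> {..?b}) \<and> (u \<notin> D \<longrightarrow> f u = 0)}"
    by (rule image_subsetI, rule bounded) simp_all
  then show "finite (Poly_Mapping.lookup ` {n. Poly_Mapping.keys n \<subseteq> D \<and> same_content D m n})"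
    by (rule finite_subset) (rule finite_set_of_finite_funs[OF assms finite_atMost])
qed (simp add: inj_on_def)

text \<open>The least monomial of a content admits no further replacement, so it is free of clashes.\<close>

lemma least_of_fibre:
  assumes D: "ferrers_diagram D" and m: "Poly_Mapping.keys m \<subseteq> D"
  obtains n where "clash_free D (Poly_Mapping.keys n)" "same_content D m n"
    "\<And>n'. Poly_Mapping.keys n' \<subseteq> D \<Longrightarrow> same_content D m n' \<Longrightarrow> n \<le> n'"
proof -
  have fin: "finite D" using D unfolding ferrers_diagram_def by simp
  let ?B = "{n. Poly_Mapping.keys n \<subseteq> D \<and> same_content D m n}"
  define n where "n = Min ?B"
  have "n \<in> ?B" unfolding n_def using finite_fibre[OF fin] m by (intro Min_in) auto
  then have n: "Poly_Mapping.keys n \<subseteq> D" "same_content D m n" by auto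
  have least: "n \<le> n'" if "Poly_Mapping.keys n' \<subseteq> D" "same_content D m n'" for n'
    unfolding n_def using finite_fibre[OF fin] that by (intro Min_le) auto
  have "\<not> clash D u v" if uv: "u \<in> Poly_Mapping.keys n" "v \<in> Poly_Mapping.keys n" for u v
  proof
    assume cl: "clash D u v"
    then have "u \<noteq> v" by auto
    then have split: "n = (n - (var u + var v)) + (var u + var v)"
      using uv by (intro poly_mapping_eqI)
        (auto simp: lookup_add lookup_minus lookup_single when_def in_keys_iff)
    obtain u' v' where uv': "u' \<in> D" "v' \<in> D" "same_content D (var u + var v) (var u' + var v')"
        "var u' + var v' < var u + var v"
      using clash_move[OF D _ _ cl, where 'k = int] uv n by blast
    define r where "r = n - (var u + var v)"
    have n_eq: "n = r + (var u + var v)" unfolding r_def by (rule split)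
    let ?n = "r + (var u' + var v')"
    have "?n < n" unfolding n_eq by (rule add_strict_left_mono[OF uv'(4)])
    moreover have "same_content D n ?n" unfolding n_eq using uv'(3) by simp
    moreover have "Poly_Mapping.keys ?n \<subseteq> D"
      using n(1) uv'(1,2) unfolding n_eq by (simp add: keys_add_monomial)
    ultimately show False using least[of ?n] same_content_trans[OF n(2), of ?n] by (simp add: leD)
  qed
  then have "clash_free D (Poly_Mapping.keys n)" unfolding clash_free_def using n(1) by blast
  then show ?thesis using that n(2) least by blast
qed

lemma reduced_monomial_least:
  assumes D: "ferrers_diagram D" "projection_property D"
    and m: "clash_free D (Poly_Mapping.keys m)" and n: "Poly_Mapping.keys n \<subseteq> D" "same_content D m n"
  shows "m \<le> n"
proof -
  have "Poly_Mapping.keys m \<subseteq> D" using m unfolding clash_free_def by simp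
  then obtain m' where m': "clash_free D (Poly_Mapping.keys m')" "same_content D m m'"
      "\<And>n'. Poly_Mapping.keys n' \<subseteq> D \<Longrightarrow> same_content D m n' \<Longrightarrow> m' \<le> n'"
    using least_of_fibre[OF D(1)] by blast
  then have "m = m'" using reduced_monomial_unique[OF D m] by blast
  then show ?thesis using m'(3)[OF n] by simp
qed

section \<open>The initial ideal\<close>

lemma tpoly_induct [case_names single add]:
  fixes p :: "'k::comm_ring_1 tpoly"
  assumes "\<And>m c. P (Poly_Mapping.single m c)" "\<And>p q. P p \<Longrightarrow> P q \<Longrightarrow> P (p + q)"
  shows "P p"
proof (induction p rule: update_induct)
  case const
  show ?case using assms(1)[of 0 0] by simp
next
  case (update f a b)
  have "Poly_Mapping.update a b f = f + Poly_Mapping.single a b"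
    using update by (intro poly_mapping_eqI) (auto simp: lookup_update lookup_add lookup_single when_def in_keys_iff)
  then show ?case using assms update by simp
qed

lemma ideal_poly_ringI:
  fixes J :: "'k::comm_ring_1 tpoly set"
  assumes sub: "J \<subseteq> carrier (poly_ring D)" and "0 \<in> J" "\<And>p q. p \<in> J \<Longrightarrow> q \<in> J \<Longrightarrow> p + q \<in> J"
    and mult: "\<And>r p. r \<in> carrier (poly_ring D) \<Longrightarrow> p \<in> J \<Longrightarrow> r * p \<in> J"
  shows "ideal J (poly_ring D)"
proof -
  interpret cring "poly_ring D :: 'k tpoly ring" by (rule cring_poly_ring)
  have ops: "x \<oplus>\<^bsub>poly_ring D\<^esub> y = x + y" "x \<otimes>\<^bsub>poly_ring D\<^esub> y = x * y" "\<zero>\<^bsub>poly_ring D\<^esub> = 0"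
    for x y :: "'k tpoly"
    unfolding poly_ring_def by simp_all
  have neg: "- p \<in> J" if "p \<in> J" for p
  proof -
    have "(- 1 :: 'k tpoly) \<in> carrier (poly_ring D)" unfolding poly_ring_def
      by (auto simp: in_keys_iff lookup_one when_def split: if_splits)
    from mult[OF this that] show ?thesis by simp
  qed
  have aneg: "\<ominus>\<^bsub>poly_ring D\<^esub> p = - p" if "p \<in> J" for p
    using that neg sub by (intro minus_equality) (auto simp: ops)
  show ?thesis
  proof (rule idealI)
    show "subgroup J (add_monoid (poly_ring D))"
      by (rule add.subgroupI) (use assms neg aneg in \<open>auto simp: ops a_inv_def[symmetric]\<close>)
    fix a x :: "'k tpoly"
    assume "a \<in> J" "x \<in> carrier (poly_ring D)"
    then show "x \<otimes>\<^bsub>poly_ring D\<^esub> a \<in> J" "a \<otimes>\<^bsub>poly_ring D\<^esub> x \<in> J"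
      using mult[of x a] by (simp_all add: ops ab_semigroup_mult_class.mult.commute[of a x])
  qed (rule ring_axioms)
qed

definition pairing :: "(monomial \<Rightarrow> 'k) \<Rightarrow> 'k::comm_ring_1 tpoly \<Rightarrow> 'k" where
  "pairing h p = (\<Sum>m \<in> Poly_Mapping.keys p. Poly_Mapping.lookup p m * h m)"

lemma pairing_add: "pairing h (p + q) = pairing h p + pairing h q"
  unfolding pairing_def by (rule setsum_keys_plus_distrib) (auto simp: algebra_simps)

lemma pairing_single: "pairing h (Poly_Mapping.single m c) = c * h m"
  unfolding pairing_def by simp

lemma pairing_diff: "pairing h (p - q) = pairing h p - pairing h q"
  using pairing_add[of h "p - q" q] by simp

lemma pairing_single_mult:
  "pairing h (Poly_Mapping.single n a * p) = a * pairing (\<lambda>m. h (n + m)) p"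
  by (induction p rule: tpoly_induct)
    (simp_all add: mult_single pairing_single pairing_add algebra_simps)

text \<open>Every linear form on polynomials that depends on monomials only through their content vanishes
  on the ideal of 2-minors. In other words, this ideal is contained in the kernel of the
  homomorphism that records the content.\<close>

definition content_kernel :: "point set \<Rightarrow> 'k::comm_ring_1 tpoly set" where
  "content_kernel D = {p \<in> carrier (poly_ring D).
     \<forall>h. (\<forall>m n. same_content D m n \<longrightarrow> h m = h n) \<longrightarrow> pairing h p = 0}"

lemma ideal_content_kernel: "ideal (content_kernel D :: 'k::comm_ring_1 tpoly set) (poly_ring D)"
proof (rule ideal_poly_ringI)
  interpret cring "poly_ring D :: 'k tpoly ring" by (rule cring_poly_ring)
  have ops: "x \<oplus>\<^bsub>poly_ring D\<^esub> y = x + y" "x \<otimes>\<^bsub>poly_ring D\<^esub> y = x * y" "\<zero>\<^bsub>poly_ring D\<^esub> = 0"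
    for x y :: "'k tpoly"
    unfolding poly_ring_def by simp_all
  show "(0 :: 'k tpoly) \<in> content_kernel D"
    unfolding content_kernel_def using zero_closed by (simp add: ops pairing_def)
  show "p + q \<in> content_kernel D" if "p \<in> content_kernel D" "q \<in> content_kernel D" for p q :: "'k tpoly"
    using that a_closed[of p q] unfolding content_kernel_def by (simp add: ops pairing_add)
  fix r p :: "'k tpoly"
  assume r: "r \<in> carrier (poly_ring D)" and p: "p \<in> content_kernel D"
  have "pairing h (r * p) = 0" if h: "\<And>m n. same_content D m n \<Longrightarrow> h m = h n" for h
  proof (induction r rule: tpoly_induct)
    case (single n a)
    have "h (n + m) = h (n + m')" if "same_content D m m'" for m m'
      using h that same_content_add_left by blast
    then show ?case using p unfolding content_kernel_def pairing_single_mult by auto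
  qed (simp add: pairing_add distrib_right)
  then show "r * p \<in> content_kernel D"
    using p m_closed[OF r, of p] unfolding content_kernel_def by (simp add: ops)
qed (auto simp: content_kernel_def)

lemma minors_in_content_kernel:
  assumes "finite D"
  shows "(minors D :: 'k::comm_ring_1 tpoly set) \<subseteq> content_kernel D"
proof
  interpret cring "poly_ring D :: 'k tpoly ring" by (rule cring_poly_ring)
  have ops: "x \<oplus>\<^bsub>poly_ring D\<^esub> y = x + y" "x \<otimes>\<^bsub>poly_ring D\<^esub> y = x * y" "\<zero>\<^bsub>poly_ring D\<^esub> = 0"
    for x y :: "'k tpoly"
    unfolding poly_ring_def by simp_all
  have zero: "(0 :: 'k tpoly) \<in> content_kernel D"
    unfolding content_kernel_def using zero_closed by (simp add: ops pairing_def)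
  have binomial: "(T u * T v - T u' * T v' :: 'k tpoly) \<in> content_kernel D"
    if "u \<in> D" "v \<in> D" "u' \<in> D" "v' \<in> D" "same_content D (var u + var v) (var u' + var v')" for u v u' v'
  proof -
    have "Poly_Mapping.keys (T u * T v - T u' * T v' :: 'k tpoly) \<subseteq> {var u + var v, var u' + var v'}"
      unfolding T_mult_T by (rule subsetI) (simp add: in_keys_iff lookup_minus lookup_single when_def split: if_splits)
    moreover have "Poly_Mapping.keys (var u + var v) \<subseteq> D" "Poly_Mapping.keys (var u' + var v') \<subseteq> D"
      using that by (simp_all add: keys_add_monomial)
    ultimately have "(T u * T v - T u' * T v' :: 'k tpoly) \<in> carrier (poly_ring D)"
      unfolding poly_ring_def by auto
    then show ?thesis
      using that unfolding content_kernel_def T_mult_T by (simp add: pairing_diff pairing_single)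
  qed
  fix g :: "'k tpoly" assume "g \<in> minors D"
  then obtain u v where uv: "u \<in> D" "v \<in> D" "g \<in> {minor_x D u v, minor_y D u v, minor_z D u v}"
    unfolding minors_def by blast
  obtain i1 j1 k1 where u: "u = (i1, j1, k1)" by (cases u)
  obtain i2 j2 k2 where v: "v = (i2, j2, k2)" by (cases v)
  note content = same_content_pair[OF assms uv(1,2)]
  have "(i2, j1, k1) \<in> D \<and> (i1, j2, k2) \<in> D \<Longrightarrow> minor_x D u v \<in> (content_kernel D :: 'k tpoly set)"
    "(i1, j2, k1) \<in> D \<and> (i2, j1, k2) \<in> D \<Longrightarrow> minor_y D u v \<in> (content_kernel D :: 'k tpoly set)"
    "(i1, j1, k2) \<in> D \<and> (i2, j2, k1) \<in> D \<Longrightarrow> minor_z D u v \<in> (content_kernel D :: 'k tpoly set)"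
    using binomial[OF uv(1,2)] content uv unfolding u v by simp_all
  then show "g \<in> content_kernel D" using uv(3) zero unfolding u v by auto
qed

lemma minors_ideal_in_content_kernel:
  assumes "finite D"
  shows "(minors_ideal D :: 'k::comm_ring_1 tpoly set) \<subseteq> content_kernel D"
proof -
  interpret cring "poly_ring D :: 'k tpoly ring" by (rule cring_poly_ring)
  show ?thesis
    unfolding minors_ideal_def minors_def[symmetric]
    by (rule genideal_minimal[OF ideal_content_kernel minors_in_content_kernel[OF assms]])
qed

text \<open>A reduced monomial \<open>m\<close> is not the leading monomial of an element of the ideal: it is the smallest
  monomial of its content, so the linear form that sums the coefficients of the monomials with the
  content of \<open>m\<close> would be nonzero on that element.\<close>

lemma lead_monomial_not_clash_free:
  assumes D: "ferrers_diagram D" "projection_property D"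
    and f: "f \<in> (minors_ideal D :: 'k::comm_ring_1 tpoly set)" "f \<noteq> 0"
  shows "lead_monomial f \<in> Poly_Mapping.keys f \<and> Poly_Mapping.keys (lead_monomial f) \<subseteq> D \<and>
    \<not> clash_free D (Poly_Mapping.keys (lead_monomial f))"
proof -
  have fin: "finite D" using D unfolding ferrers_diagram_def by simp
  have fK: "f \<in> content_kernel D" using f minors_ideal_in_content_kernel[OF fin] by blast
  let ?m = "lead_monomial f"
  have "Poly_Mapping.keys f \<noteq> {}"
    using f(2) by (metis ex_in_conv in_keys_iff lookup_zero poly_mapping_eqI)
  then have m: "?m \<in> Poly_Mapping.keys f" unfolding lead_monomial_def by simp
  have carr: "Poly_Mapping.keys n \<subseteq> D" if "n \<in> Poly_Mapping.keys f" for n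
    using fK that unfolding content_kernel_def poly_ring_def by auto
  have "\<not> clash_free D (Poly_Mapping.keys ?m)"
  proof
    assume cf: "clash_free D (Poly_Mapping.keys ?m)"
    define h where "h n = (of_bool (same_content D ?m n) :: 'k)" for n
    have "\<forall>n n'. same_content D n n' \<longrightarrow> h n = h n'"
    proof (intro allI impI)
      fix n n' assume nn': "same_content D n n'"
      have "same_content D ?m n \<longleftrightarrow> same_content D ?m n'"
        using same_content_trans[OF _ nn'] same_content_trans[OF _ same_content_sym[OF nn']] by blast
      then show "h n = h n'" unfolding h_def by simp
    qed
    then have "pairing h f = 0" using fK unfolding content_kernel_def by simp
    moreover have "h n = 0" if n: "n \<in> Poly_Mapping.keys f - {?m}" for n
    proof -
      have "n \<le> ?m" using n unfolding lead_monomial_def by simp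
      moreover have "?m \<le> n" if "same_content D ?m n"
        using reduced_monomial_least[OF D cf carr that] n by simp
      ultimately have "\<not> same_content D ?m n" using n by auto
      then show ?thesis unfolding h_def by simp
    qed
    then have "pairing h f = Poly_Mapping.lookup f ?m * h ?m"
      unfolding pairing_def using m by (subst sum.remove[of _ ?m]) auto
    ultimately show False using m unfolding h_def by (simp add: in_keys_iff)
  qed
  then show ?thesis using m carr by blast
qed

definition clashing :: "point set \<Rightarrow> 'k::comm_ring_1 tpoly set" where
  "clashing D = {p \<in> carrier (poly_ring D). \<forall>m \<in> Poly_Mapping.keys p. \<not> clash_free D (Poly_Mapping.keys m)}"

lemma ideal_clashing: "ideal (clashing D :: 'k::comm_ring_1 tpoly set) (poly_ring D)"
proof (rule ideal_poly_ringI)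
  interpret cring "poly_ring D :: 'k tpoly ring" by (rule cring_poly_ring)
  have ops: "x \<oplus>\<^bsub>poly_ring D\<^esub> y = x + y" "x \<otimes>\<^bsub>poly_ring D\<^esub> y = x * y" "\<zero>\<^bsub>poly_ring D\<^esub> = 0"
    for x y :: "'k tpoly"
    unfolding poly_ring_def by simp_all
  show "(0 :: 'k tpoly) \<in> clashing D" unfolding clashing_def using zero_closed by (simp add: ops)
  show "p + q \<in> clashing D" if "p \<in> clashing D" "q \<in> clashing D" for p q :: "'k tpoly"
    using that a_closed[of p q] Poly_Mapping.keys_add[of p q] unfolding clashing_def by (auto simp: ops)
  fix r p :: "'k tpoly"
  assume r: "r \<in> carrier (poly_ring D)" and p: "p \<in> clashing D"
  have "\<not> clash_free D (Poly_Mapping.keys m)" if m: "m \<in> Poly_Mapping.keys (r * p)" for m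
  proof -
    obtain a b where "m = a + b" "b \<in> Poly_Mapping.keys p"
      using m Poly_Mapping.keys_mult[of r p] by blast
    then show ?thesis using p clash_free_subset[of D "Poly_Mapping.keys m" "Poly_Mapping.keys b"]
      unfolding clashing_def by (auto simp: keys_add_monomial)
  qed
  then show "r * p \<in> clashing D" using p m_closed[OF r, of p] unfolding clashing_def by (simp add: ops)
qed (auto simp: clashing_def)

lemma prod_T:
  assumes "finite F"
  shows "(\<Prod>u \<in> F. T u) = (Poly_Mapping.single (\<Sum>u \<in> F. var u) 1 :: 'k::comm_ring_1 tpoly)"
  using assms by (induction F) (simp_all add: T_def mult_single)

lemma lookup_sum_single:
  assumes "finite F"
  shows "Poly_Mapping.lookup (\<Sum>u \<in> F. Poly_Mapping.single u (c u)) v = (if v \<in> F then c v else 0)"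
  using assms by (simp add: lookup_sum lookup_single when_def)

text \<open>The initial ideal lies in the monomial ideal spanned by the monomials with a clash, and each
  clash is the leading monomial of a minor.\<close>

theorem prod_T_in_initial_ideal:
  assumes D: "ferrers_diagram D" "projection_property D" and F: "F \<subseteq> D"
  shows "(\<Prod>u \<in> F. T u :: 'k::comm_ring_1 tpoly) \<in> initial_ideal D (minors_ideal D) \<longleftrightarrow> \<not> clash_free D F"
proof -
  interpret cring "poly_ring D :: 'k tpoly ring" by (rule cring_poly_ring)
  have finF: "finite F" using D F finite_subset unfolding ferrers_diagram_def by blast
  let ?gens = "{Poly_Mapping.single (lead_monomial f) 1 :: 'k tpoly | f. f \<in> (minors_ideal D :: 'k tpoly set) \<and> f \<noteq> 0}"
  have gens: "?gens \<subseteq> clashing D"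
  proof
    fix g :: "'k tpoly"
    assume "g \<in> ?gens"
    then obtain f where f: "g = Poly_Mapping.single (lead_monomial f) 1" "f \<in> (minors_ideal D :: 'k tpoly set)" "f \<noteq> 0"
      by blast
    then show "g \<in> clashing D"
      using lead_monomial_not_clash_free[OF D f(2,3)] unfolding clashing_def poly_ring_def by simp
  qed
  then have gens_carrier: "?gens \<subseteq> carrier (poly_ring D)" unfolding clashing_def by blast
  show ?thesis
  proof
    assume "(\<Prod>u \<in> F. T u :: 'k tpoly) \<in> initial_ideal D (minors_ideal D)"
    then have "(\<Prod>u \<in> F. T u :: 'k tpoly) \<in> clashing D"
      using genideal_minimal[OF ideal_clashing gens] unfolding initial_ideal_def by blast
    moreover have "Poly_Mapping.keys (\<Sum>u \<in> F. var u) = F"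
      by (auto simp: in_keys_iff lookup_sum_single[OF finF] split: if_splits)
    ultimately show "\<not> clash_free D F" unfolding prod_T[OF finF] clashing_def by simp
  next
    assume "\<not> clash_free D F"
    then obtain u v where uv: "u \<in> F" "v \<in> F" "clash D u v" using F unfolding clash_free_def by blast
    have "u \<noteq> v" using uv by auto
    define a where "a = var u + var v"
    have "\<exists>b < a. (Poly_Mapping.single a 1 - Poly_Mapping.single b 1 :: 'k tpoly) \<in> minors D"
      using clash_move[OF D(1) _ _ uv(3), where 'k = 'k] uv F unfolding a_def T_mult_T by blast
    then obtain b where b: "b < a" "(Poly_Mapping.single a 1 - Poly_Mapping.single b 1 :: 'k tpoly) \<in> minors D"
      by blast
    let ?g = "Poly_Mapping.single a 1 - Poly_Mapping.single b 1 :: 'k tpoly"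
    have "minors D \<subseteq> carrier (poly_ring D :: 'k tpoly ring)"
      using minors_in_content_kernel D unfolding ferrers_diagram_def content_kernel_def by blast
    then have g: "?g \<in> minors_ideal D"
      using genideal_self b(2) unfolding minors_ideal_def minors_def[symmetric] by blast
    have "Poly_Mapping.keys ?g = {a, b}"
      using b(1) by (auto simp: in_keys_iff lookup_minus lookup_single when_def split: if_splits)
    then have "lead_monomial ?g = a" "?g \<noteq> 0"
      unfolding lead_monomial_def using b(1) by (auto simp: max.absorb1)
    then have "Poly_Mapping.single a 1 \<in> ?gens"
      using g by (intro CollectI exI[of _ ?g] conjI) simp_all
    then have lead: "Poly_Mapping.single a 1 \<in> (initial_ideal D (minors_ideal D) :: 'k tpoly set)"
      unfolding initial_ideal_def by (rule subsetD[OF genideal_self[OF gens_carrier]])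
    have rest: "(\<Prod>w \<in> F - {u, v}. T w :: 'k tpoly) \<in> carrier (poly_ring D)"
    proof -
      have "Poly_Mapping.keys (\<Sum>w \<in> F - {u, v}. var w) \<subseteq> D"
        using F finF by (auto simp: in_keys_iff lookup_sum_single split: if_splits)
      then show ?thesis using finF by (simp add: prod_T poly_ring_def)
    qed
    have "(\<Prod>w \<in> F. T w :: 'k tpoly) = (\<Prod>w \<in> F - {u, v}. T w) * (T u * T v)"
    proof -
      have "F = insert u (insert v (F - {u, v}))" using uv by auto
      then have "(\<Prod>w \<in> F. T w :: 'k tpoly) = (\<Prod>w \<in> insert u (insert v (F - {u, v})). T w)"
        by (rule arg_cong)
      also have "\<dots> = (\<Prod>w \<in> F - {u, v}. T w) * (T u * T v)"
        using finF \<open>u \<noteq> v\<close> by (simp add: ac_simps)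
      finally show ?thesis .
    qed
    moreover have "ideal (initial_ideal D (minors_ideal D) :: 'k tpoly set) (poly_ring D)"
      unfolding initial_ideal_def by (rule genideal_ideal[OF gens_carrier])
    ultimately show "(\<Prod>u \<in> F. T u :: 'k tpoly) \<in> initial_ideal D (minors_ideal D)"
      using ideal.I_l_closed[OF _ lead rest] unfolding T_mult_T a_def by (simp add: poly_ring_def)
  qed
qed

lemma T_eq_iff [simp]: "(T u :: 'k::comm_ring_1 tpoly) = T v \<longleftrightarrow> u = v"
proof
  assume "(T u :: 'k tpoly) = T v"
  then have "Poly_Mapping.keys (T u :: 'k tpoly) = Poly_Mapping.keys (T v :: 'k tpoly)" by simp
  then have "var u = var v" unfolding T_def by simp
  then have "Poly_Mapping.keys (var u) = Poly_Mapping.keys (var v)" by simp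
  then show "u = v" by simp
qed simp

lemma Delta_eq:
  assumes D: "ferrers_diagram D" "projection_property D"
  shows "(Delta D :: 'k::comm_ring_1 tpoly set set) = (`) T ` {F. clash_free D F}"
proof -
  have "inj_on (T :: point \<Rightarrow> 'k tpoly) F" for F by (simp add: inj_on_def)
  then have "(\<Prod>t \<in> T ` F. t :: 'k tpoly) = (\<Prod>u \<in> F. T u)" for F by (simp add: prod.reindex)
  then have mem: "T ` F \<in> (Delta D :: 'k tpoly set set) \<longleftrightarrow> clash_free D F" if "F \<subseteq> D" for F
    unfolding Delta_def using that prod_T_in_initial_ideal[OF D that, where 'k = 'k] by auto
  show ?thesis
  proof (intro equalityI subsetI)
    fix G assume G: "G \<in> (Delta D :: 'k tpoly set set)"
    then obtain F where "F \<subseteq> D" "G = T ` F" unfolding Delta_def by (auto simp: subset_image_iff)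
    then show "G \<in> (`) T ` {F. clash_free D F}" using G mem by simp
  next
    fix G :: "'k tpoly set" assume "G \<in> (`) T ` {F. clash_free D F}"
    then obtain F where F: "clash_free D F" "G = T ` F" by blast
    then have "F \<subseteq> D" unfolding clash_free_def by simp
    then show "G \<in> Delta D" using F mem by simp
  qed
qed

section \<open>Purity\<close>

text \<open>The exponent vector of \<open>x\<^sub>i y\<^sub>j z\<^sub>k\<close>, with an entry for every set of indices instead of every
  index, as in the definition of content.\<close>

definition coord :: "nat \<Rightarrow> point \<Rightarrow> nat" where
  "coord s u = (if s = 0 then px u else if s = 1 then py u else pz u)"

definition content_vec :: "point \<Rightarrow> nat \<times> (nat \<Rightarrow> bool) \<Rightarrow> rat" where
  "content_vec u = (\<lambda>(s, Q). of_bool (Q (coord s u)))"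

lemma same_content_iff_vec:
  "same_content D m m' \<longleftrightarrow>
    (\<forall>x. (\<Sum>u \<in> D. of_nat (Poly_Mapping.lookup m u) * content_vec u x) =
         (\<Sum>u \<in> D. of_nat (Poly_Mapping.lookup m' u) * content_vec u x))"
proof -
  have w: "(\<Sum>u \<in> D. of_nat (Poly_Mapping.lookup n u) * content_vec u (s, Q)) =
      (of_nat (weight D n (\<lambda>u. Q (coord s u))) :: rat)" for n Q and s :: nat
    unfolding weight_def content_vec_def of_nat_sum
    by (intro sum.cong refl) (simp add: of_bool_def)
  have "(\<forall>x. (\<Sum>u \<in> D. of_nat (Poly_Mapping.lookup m u) * content_vec u x) =
         (\<Sum>u \<in> D. of_nat (Poly_Mapping.lookup m' u) * content_vec u x)) \<longleftrightarrow>
      (\<forall>s Q. weight D m (\<lambda>u. Q (coord s u)) = weight D m' (\<lambda>u. Q (coord s u)))"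
    by (simp add: w split_paired_all)
  also have "\<dots> \<longleftrightarrow> same_content D m m'"
  proof
    assume a: "\<forall>s Q. weight D m (\<lambda>u. Q (coord s u)) = weight D m' (\<lambda>u. Q (coord s u))"
    show "same_content D m m'"
      unfolding same_content_def using a[rule_format, of _ 0] a[rule_format, of _ 1] a[rule_format, of _ 2]
      by (simp add: coord_def)
  next
    assume a: "same_content D m m'"
    show "\<forall>s Q. weight D m (\<lambda>u. Q (coord s u)) = weight D m' (\<lambda>u. Q (coord s u))"
    proof (intro allI)
      fix s :: nat and Q
      consider "s = 0" | "s = 1" | "s \<noteq> 0" "s \<noteq> 1" by blast
      then show "weight D m (\<lambda>u. Q (coord s u)) = weight D m' (\<lambda>u. Q (coord s u))"
        using a unfolding same_content_def by cases (simp_all add: coord_def)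
    qed
  qed
  finally show ?thesis by simp
qed

lemma inj_content_vec: "inj content_vec"
proof (rule injI)
  fix u v assume "content_vec u = content_vec v"
  then have eq: "content_vec u (s, \<lambda>a. a = coord s u) = content_vec v (s, \<lambda>a. a = coord s u)" for s by simp
  have "coord s u = coord s v" for s
    using eq[of s] unfolding content_vec_def by (simp split: if_splits)
  from this[of 0] this[of 1] this[of 2] show "u = v" unfolding coord_def by (simp add: prod_eq_iff)
qed

interpretation fun_rat: vector_space "\<lambda>(c :: rat) (f :: nat \<times> (nat \<Rightarrow> bool) \<Rightarrow> rat) x. c * f x"
  by standard (auto simp: fun_eq_iff algebra_simps)

lemma common_denominator:
  fixes r :: "'a \<Rightarrow> rat"
  assumes "finite F"
  shows "\<exists>N > 0. \<exists>c :: 'a \<Rightarrow> int. \<forall>u \<in> F. of_nat N * r u = of_int (c u)"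
  using assms
proof (induction F)
  case empty
  show ?case by (intro exI[of _ 1]) simp
next
  case (insert v F)
  then obtain N c where N: "N > 0" "\<forall>u \<in> F. of_nat N * r u = of_int (c u)" by blast
  obtain a b where "quotient_of (r v) = (a, b)" by (cases "quotient_of (r v)")
  then have ab: "r v = of_int a / of_int b" "b > 0"
    using quotient_of_div quotient_of_denom_pos by auto
  have "of_nat (N * nat b) * r u = of_int (if u = v then int N * a else b * c u)" if "u \<in> insert v F" for u
  proof (cases "u = v")
    case True
    then show ?thesis using ab by (simp add: of_nat_nat)
  next
    case False
    then have "of_nat N * r u = of_int (c u)" using that N by simp
    then have "of_nat N * r u * of_int b = of_int (c u) * of_int b" by simp
    then show ?thesis using False ab by (simp add: algebra_simps)
  qed
  moreover have "N * nat b > 0" using N ab by simp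
  ultimately show ?case
    by (intro exI[of _ "N * nat b"] exI[of _ "\<lambda>u. if u = v then int N * a else b * c u"] conjI ballI)
qed

lemma sum_over_superset:
  fixes c :: "point \<Rightarrow> nat"
  assumes "finite D" "F \<subseteq> D"
  shows "(\<Sum>u \<in> D. of_nat (Poly_Mapping.lookup (\<Sum>u \<in> F. Poly_Mapping.single u (c u)) u) * f u) =
    (\<Sum>u \<in> F. of_nat (c u) * f u :: rat)"
proof -
  have "finite F" using assms finite_subset by blast
  then have "(\<Sum>u \<in> D. of_nat (Poly_Mapping.lookup (\<Sum>u \<in> F. Poly_Mapping.single u (c u)) u) * f u) =
      (\<Sum>u \<in> D. if u \<in> F then of_nat (c u) * f u else 0)"
    by (intro sum.cong refl) (simp add: lookup_sum_single)
  also have "\<dots> = (\<Sum>u \<in> F. of_nat (c u) * f u)"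
    using assms by (simp add: sum.inter_restrict[symmetric] Int_absorb1)
  finally show ?thesis .
qed

text \<open>A linear relation among the vectors of a clash-free set, cleared of denominators, would give
  two reduced monomials with the same content.\<close>

lemma clash_free_independent:
  assumes D: "ferrers_diagram D" "projection_property D" and F: "clash_free D F"
  shows "fun_rat.independent (content_vec ` F)"
proof
  have fin: "finite D" using D unfolding ferrers_diagram_def by simp
  have FD: "F \<subseteq> D" using F unfolding clash_free_def by simp
  then have finF: "finite F" using fin finite_subset by blast
  assume "fun_rat.dependent (content_vec ` F)"
  then obtain a where a: "\<exists>v \<in> content_vec ` F. a v \<noteq> 0"
      "(\<Sum>v \<in> content_vec ` F. (\<lambda>x. a v * v x)) = 0"
    using fun_rat.dependent_finite[of "content_vec ` F"] finF by auto
  define r where "r u = a (content_vec u)" for u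
  have rel: "(\<Sum>u \<in> F. r u * content_vec u x) = 0" for x
  proof -
    have "(\<Sum>v \<in> content_vec ` F. a v * v x) = (\<Sum>v \<in> content_vec ` F. (\<lambda>x. a v * v x)) x"
      using finF by (induction F) (simp_all add: sum.insert_if)
    also have "\<dots> = 0" using a(2) by simp
    finally show ?thesis
      unfolding r_def by (simp add: sum.reindex[OF inj_on_subset[OF inj_content_vec subset_UNIV]])
  qed
  obtain N c where N: "N > 0" "\<And>u. u \<in> F \<Longrightarrow> of_nat N * r u = of_int (c u)"
    using common_denominator[OF finF, of r] by blast
  define pos neg where "pos = (\<Sum>u \<in> F. Poly_Mapping.single u (nat (c u)))"
    and "neg = (\<Sum>u \<in> F. Poly_Mapping.single u (nat (- c u)))"
  have lookups: "Poly_Mapping.lookup pos u = (if u \<in> F then nat (c u) else 0)"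
    "Poly_Mapping.lookup neg u = (if u \<in> F then nat (- c u) else 0)" for u
    unfolding pos_def neg_def using finF by (simp_all add: lookup_sum_single)
  have "(\<Sum>u \<in> F. of_nat (nat (c u)) * content_vec u x) = (\<Sum>u \<in> F. of_nat (nat (- c u)) * content_vec u x)" for x
  proof -
    have "(\<Sum>u \<in> F. of_nat (nat (c u)) * content_vec u x) - (\<Sum>u \<in> F. of_nat (nat (- c u)) * content_vec u x) =
        (\<Sum>u \<in> F. of_int (c u) * content_vec u x)"
      unfolding sum_subtractf[symmetric]
    proof (intro sum.cong refl)
      fix u
      have "(of_nat (nat (c u)) :: rat) - of_nat (nat (- c u)) = of_int (c u)"
        by (cases "c u \<ge> 0") (simp_all add: of_nat_nat)
      then show "of_nat (nat (c u)) * content_vec u x - of_nat (nat (- c u)) * content_vec u x =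
          of_int (c u) * content_vec u x"
        by (simp only: left_diff_distrib[symmetric])
    qed
    also have "\<dots> = (\<Sum>u \<in> F. of_nat N * (r u * content_vec u x))"
      by (intro sum.cong refl) (simp add: N(2)[symmetric])
    also have "\<dots> = 0" using rel[of x] by (simp add: sum_distrib_left[symmetric])
    finally show ?thesis by simp
  qed
  then have "same_content D pos neg"
    unfolding same_content_iff_vec pos_def neg_def sum_over_superset[OF fin FD] by simp
  moreover have "Poly_Mapping.keys pos \<subseteq> F" "Poly_Mapping.keys neg \<subseteq> F"
    by (auto simp: in_keys_iff lookups split: if_splits)
  then have "clash_free D (Poly_Mapping.keys pos)" "clash_free D (Poly_Mapping.keys neg)"
    using F clash_free_subset by blast+
  ultimately have "pos = neg" using reduced_monomial_unique[OF D] by blast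
  have "r u = 0" if "u \<in> F" for u
  proof -
    have "Poly_Mapping.lookup pos u = Poly_Mapping.lookup neg u" using \<open>pos = neg\<close> by simp
    then have "nat (c u) = nat (- c u)" using that by (simp add: lookups)
    then have "c u = 0" by linarith
    then show ?thesis using N(1) N(2)[OF that] by simp
  qed
  then show False using a(1) unfolding r_def by blast
qed

lemma nat_sequence_incseq_subseq:
  fixes f :: "nat \<Rightarrow> nat"
  shows "\<exists>g :: nat \<Rightarrow> nat. strict_mono g \<and> incseq (f \<circ> g)"
proof -
  obtain g where g: "strict_mono g" "monoseq (\<lambda>n. f (g n))" using seq_monosub by blast
  show ?thesis
  proof (cases "incseq (\<lambda>n. f (g n))")
    case True
    then show ?thesis using g by (auto simp: comp_def)
  next
    case False
    then have dec: "decseq (\<lambda>n. f (g n))"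
      using g(2) unfolding monoseq_iff by simp
    \<comment> \<open>A decreasing sequence of natural numbers is constant from where its minimum is attained.\<close>
    have "\<exists>k. \<forall>n. f (g k) \<le> f (g n)"
      using ex_has_least_nat[of "\<lambda>_. True" 0 "\<lambda>n. f (g n)"] by simp
    then obtain k where k: "\<And>n. f (g k) \<le> f (g n)" by meson
    have const: "f (g (n + k)) = f (g k)" for n
      using k[of "n + k"] decseqD[OF dec, of k "n + k"] by simp
    have "strict_mono (\<lambda>n. g (n + k))" using g(1) unfolding strict_mono_def by simp
    moreover have "incseq (f \<circ> (\<lambda>n. g (n + k)))" by (simp add: incseq_def const)
    ultimately show ?thesis by blast
  qed
qed

lemma dickson_lemma:
  fixes f :: "nat \<Rightarrow> 'a \<Rightarrow> nat"
  assumes "finite A"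
  shows "\<exists>m n. m < n \<and> (\<forall>u \<in> A. f m u \<le> f n u)"
proof -
  have "\<exists>g :: nat \<Rightarrow> nat. strict_mono g \<and> (\<forall>u \<in> A. incseq (\<lambda>n. f (g n) u))"
    using assms
  proof (induction A)
    case empty
    show ?case by (intro exI[of _ id]) (simp add: strict_mono_def)
  next
    case (insert v A)
    then obtain g :: "nat \<Rightarrow> nat" where g: "strict_mono g" "\<forall>u \<in> A. incseq (\<lambda>n. f (g n) u)" by blast
    obtain h :: "nat \<Rightarrow> nat" where h: "strict_mono h" "incseq ((\<lambda>n. f (g n) v) \<circ> h)"
      using nat_sequence_incseq_subseq by blast
    have "incseq (\<lambda>n. f (g (h n)) u)" if "u \<in> insert v A" for u
    proof (cases "u = v")
      case True
      then show ?thesis using h(2) by (simp add: comp_def)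
    next
      case False
      then have "incseq (\<lambda>n. f (g n) u)" using that g(2) by simp
      then show ?thesis using strict_mono_mono[OF h(1)] unfolding incseq_def mono_def by simp
    qed
    moreover have "strict_mono (\<lambda>n. g (h n))" using g(1) h(1) unfolding strict_mono_def by simp
    ultimately show ?case by (intro exI[of _ "\<lambda>n. g (h n)"]) simp
  qed
  then obtain g :: "nat \<Rightarrow> nat" where g: "strict_mono g" "\<forall>u \<in> A. incseq (\<lambda>n. f (g n) u)" by blast
  have "g 0 < g 1" using g(1) unfolding strict_mono_def by simp
  moreover have "\<forall>u \<in> A. f (g 0) u \<le> f (g 1) u" using g(2) unfolding incseq_def by simp
  ultimately show ?thesis by blast
qed

text \<open>Write \<open>F\<close> also for the product of its points. Among the normal forms of the monomials
  \<open>w * F ^ N\<close>, one divides a later one, by Dickson's lemma. The quotient has the content of a power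
  of \<open>F\<close>, hence is that power, so that the support of the larger normal form contains \<open>F\<close>. By
  maximality it equals \<open>F\<close>, and the content of \<open>w\<close> is an integral combination of those of \<open>F\<close>.\<close>

lemma maximal_clash_free_spans:
  assumes D: "ferrers_diagram D" "projection_property D" and F: "clash_free D F"
    and max: "\<And>G. clash_free D G \<Longrightarrow> F \<subseteq> G \<Longrightarrow> F = G" and w: "w \<in> D"
  shows "content_vec w \<in> fun_rat.span (content_vec ` F)"
proof -
  have fin: "finite D" using D unfolding ferrers_diagram_def by simp
  have FD: "F \<subseteq> D" using F unfolding clash_free_def by simp
  then have finF: "finite F" using fin finite_subset by blast
  define pw where "pw N = (\<Sum>u \<in> F. Poly_Mapping.single u N)" for N :: nat
  have pw: "Poly_Mapping.lookup (pw N) u = (if u \<in> F then N else 0)" for N u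
    unfolding pw_def using finF by (simp add: lookup_sum_single)
  have pw_add: "pw (M + N) = pw M + pw N" for M N
    by (intro poly_mapping_eqI) (simp add: lookup_add pw)
  have keys: "Poly_Mapping.keys (var w + pw N) \<subseteq> D" for N
    using FD w by (auto simp: keys_add_monomial in_keys_iff pw split: if_splits)
  have "\<forall>N. \<exists>n. clash_free D (Poly_Mapping.keys n) \<and> same_content D (var w + pw N) n"
    using least_of_fibre[OF D(1) keys] by blast
  then obtain nf where nf: "\<And>N. clash_free D (Poly_Mapping.keys (nf N))"
      "\<And>N. same_content D (var w + pw N) (nf N)"
    by metis
  obtain M N where MN: "M < N" "\<forall>u \<in> D. Poly_Mapping.lookup (nf M) u \<le> Poly_Mapping.lookup (nf N) u"
    using dickson_lemma[OF fin, of "\<lambda>N. Poly_Mapping.lookup (nf N)"] by blast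
  define d where "d = nf N - nf M"
  have keysD: "Poly_Mapping.keys (nf N) \<subseteq> D" for N using nf(1)[of N] unfolding clash_free_def by simp
  have split: "nf N = nf M + d"
    unfolding d_def
  proof (rule poly_mapping_eqI)
    fix u
    have "Poly_Mapping.lookup (nf M) u \<le> Poly_Mapping.lookup (nf N) u"
    proof (cases "u \<in> Poly_Mapping.keys (nf M)")
      case True
      then have "u \<in> D" using keysD[of M] by blast
      then show ?thesis using MN(2) by blast
    qed (simp add: in_keys_iff)
    then show "Poly_Mapping.lookup (nf N) u = Poly_Mapping.lookup (nf M + (nf N - nf M)) u"
      by (simp add: lookup_add lookup_minus)
  qed
  have eq1: "same_content D (nf M + d) ((var w + pw M) + pw (N - M))"
    using nf(2)[of N] pw_add[of M "N - M"] MN(1) split by (simp add: add.assoc same_content_sym)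
  have "same_content D (d + nf M) (pw (N - M) + nf M)"
    using same_content_trans[OF eq1, of "pw (N - M) + nf M"] nf(2)[of M]
      same_content_add_left[of D "pw (N - M)" "var w + pw M" "nf M"]
    by (simp only: add.commute[of d] add.commute[of "var w + pw M"])
  then have "same_content D d (pw (N - M))"
    using same_content_add_left[of D "nf M" d "pw (N - M)"] by (simp only: add.commute[of _ "nf M"])
  moreover have keys_d: "Poly_Mapping.keys d \<subseteq> Poly_Mapping.keys (nf N)"
    unfolding split keys_add_monomial by simp
  then have "clash_free D (Poly_Mapping.keys d)" using nf(1) clash_free_subset by blast
  moreover have keys_pw: "Poly_Mapping.keys (pw (N - M)) = F"
    using MN(1) by (auto simp: in_keys_iff pw split: if_splits)
  ultimately have "d = pw (N - M)" using reduced_monomial_unique[OF D] F by simp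
  then have "F \<subseteq> Poly_Mapping.keys (nf N)" using keys_d keys_pw by simp
  then have "Poly_Mapping.keys (nf N) = F" by (rule max[OF nf(1), symmetric])
  then have keysM: "Poly_Mapping.keys (nf M) \<subseteq> F"
    using split keys_add_monomial[of "nf M" d] by auto
  let ?c = "\<lambda>u. (of_nat (Poly_Mapping.lookup (nf M) u) - of_nat M :: rat)"
  have "content_vec w x = (\<Sum>u \<in> F. ?c u * content_vec u x)" for x
  proof -
    have "(\<Sum>u \<in> D. of_nat (Poly_Mapping.lookup (var w + pw M) u) * content_vec u x) =
        (\<Sum>u \<in> D. of_nat (Poly_Mapping.lookup (nf M) u) * content_vec u x)"
      using nf(2)[of M] unfolding same_content_iff_vec by blast
    moreover have "(\<Sum>u \<in> D. of_nat (Poly_Mapping.lookup (var w + pw M) u) * content_vec u x) =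
        (\<Sum>u \<in> D. (if u = w then content_vec u x else 0)) +
        (\<Sum>u \<in> D. of_nat (Poly_Mapping.lookup (pw M) u) * content_vec u x)"
      unfolding sum.distrib[symmetric]
      by (intro sum.cong refl) (simp add: lookup_add lookup_single when_def algebra_simps)
    moreover have "(\<Sum>u \<in> D. (if u = w then content_vec u x else 0)) = content_vec w x"
      using fin w by simp
    moreover have "(\<Sum>u \<in> D. of_nat (Poly_Mapping.lookup (pw M) u) * content_vec u x) =
        (\<Sum>u \<in> F. of_nat M * content_vec u x)"
      unfolding pw_def by (rule sum_over_superset[OF fin FD])
    moreover have "(\<Sum>u \<in> D. of_nat (Poly_Mapping.lookup (nf M) u) * content_vec u x) =
        (\<Sum>u \<in> F. of_nat (Poly_Mapping.lookup (nf M) u) * content_vec u x)"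
      using keysM by (intro sum.mono_neutral_right[OF fin FD]) (auto simp: in_keys_iff subset_iff)
    ultimately have "content_vec w x = (\<Sum>u \<in> F. of_nat (Poly_Mapping.lookup (nf M) u) * content_vec u x) -
        (\<Sum>u \<in> F. of_nat M * content_vec u x)" by simp
    also have "\<dots> = (\<Sum>u \<in> F. ?c u * content_vec u x)"
      by (simp add: sum_subtractf[symmetric] left_diff_distrib)
    finally show ?thesis .
  qed
  moreover have "(\<Sum>u \<in> F. (\<lambda>x. ?c u * content_vec u x)) x = (\<Sum>u \<in> F. ?c u * content_vec u x)" for x
    using finF by (induction F) simp_all
  ultimately have "content_vec w = (\<Sum>u \<in> F. (\<lambda>x. ?c u * content_vec u x))"
    by (intro ext) simp
  also have "\<dots> \<in> fun_rat.span (content_vec ` F)"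
    by (intro fun_rat.span_sum fun_rat.span_scale fun_rat.span_base imageI)
  finally show ?thesis .
qed

section \<open>The hook\<close>

definition hook :: "point set \<Rightarrow> point set" where
  "hook D = {(i, j, k) \<in> D. j = 1 \<and> k = 1 \<or> i = 1 \<and> k = 1 \<or> i = 1 \<and> j = 1}"

lemma clash_free_hook:
  assumes "ferrers_diagram D"
  shows "clash_free D (hook D)"
proof -
  have "\<not> clash D u v" if "u \<in> hook D" "v \<in> hook D" for u v
  proof -
    obtain i j k where u: "u = (i, j, k)" by (cases u)
    obtain i' j' k' where v: "v = (i', j', k')" by (cases v)
    have "1 \<le> i" "1 \<le> j" "1 \<le> k" using that ferrers_pos[OF assms] unfolding hook_def u by auto
    then show ?thesis using that unfolding hook_def u v by auto
  qed
  then show ?thesis unfolding clash_free_def hook_def by auto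
qed

lemma card_hook:
  assumes D: "ferrers_diagram D"
  shows "card (hook D) + 2 = num_x D + num_y D + num_z D"
proof -
  note down = ferrers_down[OF D] and pos = ferrers_pos[OF D]
  have fin: "finite D" "D \<noteq> {}" using D unfolding ferrers_diagram_def by auto
  obtain i0 j0 k0 where "(i0, j0, k0) \<in> D" using fin(2) by (metis ex_in_conv prod_cases3)
  then have origin: "(1, 1, 1) \<in> D" using down[of i0 j0 k0 1 1 1] pos[of i0 j0 k0] by simp
  let ?X = "{(i, 1, 1) | i. (i, 1, 1) \<in> D} :: point set"
    and ?Y = "{(1, j, 1) | j. (1, j, 1) \<in> D} :: point set"
    and ?Z = "{(1, 1, k) | k. (1, 1, k) \<in> D} :: point set"
  have sub: "?X \<subseteq> D" "?Y \<subseteq> D" "?Z \<subseteq> D" by auto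
  note finXYZ = finite_subset[OF sub(1) fin(1)] finite_subset[OF sub(2) fin(1)] finite_subset[OF sub(3) fin(1)]
  have "(\<lambda>(i, j, k). i) ` D = (\<lambda>(i, j, k). i) ` ?X"
  proof
    show "(\<lambda>(i, j, k). i) ` D \<subseteq> (\<lambda>(i, j, k). i) ` ?X"
    proof (rule image_subsetI, clarify)
      fix i j k assume u: "(i, j, k) \<in> D"
      have "(i, 1, 1) \<in> ?X" using down[OF u, of i 1 1] pos[OF u] by simp
      then show "i \<in> (\<lambda>(i, j, k). i) ` ?X" by (rule rev_image_eqI) simp
    qed
  qed (rule image_mono[OF sub(1)])
  then have "num_x D = card ?X"
    unfolding num_x_def by (simp only:) (rule card_image, auto simp: inj_on_def)
  have "(\<lambda>(i, j, k). j) ` D = (\<lambda>(i, j, k). j) ` ?Y"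
  proof
    show "(\<lambda>(i, j, k). j) ` D \<subseteq> (\<lambda>(i, j, k). j) ` ?Y"
    proof (rule image_subsetI, clarify)
      fix i j k assume u: "(i, j, k) \<in> D"
      have "(1, j, 1) \<in> ?Y" using down[OF u, of 1 j 1] pos[OF u] by simp
      then show "j \<in> (\<lambda>(i, j, k). j) ` ?Y" by (rule rev_image_eqI) simp
    qed
  qed (rule image_mono[OF sub(2)])
  then have "num_y D = card ?Y"
    unfolding num_y_def by (simp only:) (rule card_image, auto simp: inj_on_def)
  have "(\<lambda>(i, j, k). k) ` D = (\<lambda>(i, j, k). k) ` ?Z"
  proof
    show "(\<lambda>(i, j, k). k) ` D \<subseteq> (\<lambda>(i, j, k). k) ` ?Z"
    proof (rule image_subsetI, clarify)
      fix i j k assume u: "(i, j, k) \<in> D"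
      have "(1, 1, k) \<in> ?Z" using down[OF u, of 1 1 k] pos[OF u] by simp
      then show "k \<in> (\<lambda>(i, j, k). k) ` ?Z" by (rule rev_image_eqI) simp
    qed
  qed (rule image_mono[OF sub(3)])
  then have "num_z D = card ?Z"
    unfolding num_z_def by (simp only:) (rule card_image, auto simp: inj_on_def)
  have "hook D = ?X \<union> ?Y \<union> ?Z" unfolding hook_def by auto
  moreover have "(?X \<union> ?Y) \<inter> ?Z = {(1, 1, 1)}" "?X \<inter> ?Y = {(1, 1, 1)}" using origin by auto
  ultimately have "card (hook D) + 1 = card (?X \<union> ?Y) + card ?Z" "card (?X \<union> ?Y) + 1 = card ?X + card ?Y"
    using card_Un_Int[of "?X \<union> ?Y" ?Z] card_Un_Int[of ?X ?Y] finXYZ by simp_all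
  then show ?thesis using \<open>num_x D = card ?X\<close> \<open>num_y D = card ?Y\<close> \<open>num_z D = card ?Z\<close> by linarith
qed

lemma hook_spans:
  assumes D: "ferrers_diagram D" and u: "u \<in> D"
  shows "content_vec u \<in> fun_rat.span (content_vec ` hook D)"
proof -
  obtain i j k where u_eq: "u = (i, j, k)" by (cases u)
  note down = ferrers_down[OF D u[unfolded u_eq]] and pos = ferrers_pos[OF D u[unfolded u_eq]]
  have "(i, 1, 1) \<in> hook D" "(1, j, 1) \<in> hook D" "(1, 1, k) \<in> hook D" "(1, 1, 1) \<in> hook D"
    using down[of i 1 1] down[of 1 j 1] down[of 1 1 k] down[of 1 1 1] pos unfolding hook_def by simp_all
  note base = this[THEN fun_rat.span_base[OF imageI[where f = content_vec]]]
  have "content_vec u = content_vec (i, 1, 1) + content_vec (1, j, 1) + content_vec (1, 1, k)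
      - (\<lambda>x. 2 * content_vec (1, 1, 1) x)"
    unfolding u_eq content_vec_def coord_def by (auto simp: fun_eq_iff)
  then show ?thesis
    using fun_rat.span_diff[OF fun_rat.span_add[OF fun_rat.span_add[OF base(1,2)] base(3)]
        fun_rat.span_scale[OF base(4), of 2]] by simp
qed

text \<open>A maximal clash-free set and the hook, itself clash-free, provide two bases of the same space.\<close>

theorem card_maximal_clash_free:
  assumes D: "ferrers_diagram D" "projection_property D" and F: "clash_free D F"
    and max: "\<And>G. clash_free D G \<Longrightarrow> F \<subseteq> G \<Longrightarrow> F = G"
  shows "card F = card (hook D)"
proof -
  have fin: "finite D" using D unfolding ferrers_diagram_def by simp
  have FD: "F \<subseteq> D" "hook D \<subseteq> D" using F unfolding clash_free_def hook_def by auto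
  then have finite: "finite F" "finite (hook D)" using fin finite_subset by blast+
  note indep = clash_free_independent[OF D]
  have "content_vec ` hook D \<subseteq> fun_rat.span (content_vec ` F)"
    using maximal_clash_free_spans[OF D F max] FD by (intro image_subsetI) blast
  then have "card (content_vec ` hook D) \<le> card (content_vec ` F)"
    using fun_rat.independent_span_bound[OF finite_imageI[OF finite(1)] indep[OF clash_free_hook[OF D(1)]]] by simp
  moreover have "content_vec ` F \<subseteq> fun_rat.span (content_vec ` hook D)"
    using hook_spans[OF D(1)] FD by (intro image_subsetI) blast
  then have "card (content_vec ` F) \<le> card (content_vec ` hook D)"
    using fun_rat.independent_span_bound[OF finite_imageI[OF finite(2)] indep[OF F]] by simp
  moreover have "card (content_vec ` A) = card A" for A
    by (rule card_image) (rule inj_on_subset[OF inj_content_vec subset_UNIV])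
  ultimately show ?thesis by simp
qed

section \<open>The initial complex\<close>

lemma clash_free_compatible_insert:
  assumes "clash_free D (insert v S)" "clash_free D (S \<union> G)" "G \<subseteq> D" "\<And>g. g \<in> G \<Longrightarrow> v < g"
    and "\<And>g. g \<in> G \<Longrightarrow> \<not> clash D v g"
  shows "clash_free D (insert v (S \<union> G))"
proof (rule clash_free_insert[OF assms(2)])
  show "v \<in> D" using assms(1) unfolding clash_free_def by simp
  fix u assume "u \<in> S \<union> G"
  then show "\<not> clash D u v \<and> \<not> clash D v u"
  proof
    assume "u \<in> S"
    then show ?thesis using clash_freeD[OF assms(1)] by simp
  next
    assume "u \<in> G"
    then show ?thesis using assms(4,5)[of u] clash_less[of D u v] by auto
  qed
qed

lemma pure_Delta:
  assumes D: "ferrers_diagram D" "projection_property D"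
  shows "pure_of_size (card (hook D)) (Delta D :: 'k::comm_ring_1 tpoly set set)"
proof -
  let ?T = "T :: point \<Rightarrow> 'k tpoly"
  have inj: "inj ?T" by (simp add: inj_on_def)
  have fin: "finite D" using D unfolding ferrers_diagram_def by simp
  have verts: "F \<subseteq> T ` D" if "F \<in> (Delta D :: 'k tpoly set set)" for F
    using that unfolding Delta_def by simp
  have "G \<in> Delta D" if F: "F \<in> (Delta D :: 'k tpoly set set)" and G: "G \<subseteq> F" for F G
  proof -
    obtain A where A: "clash_free D A" "F = T ` A" using F unfolding Delta_eq[OF D] by blast
    then obtain B where B: "B \<subseteq> A" "G = T ` B" using G by (auto simp: subset_image_iff)
    then have "clash_free D B" using A clash_free_subset by simp
    then show ?thesis unfolding Delta_eq[OF D] using B by simp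
  qed
  moreover have "\<Union>(Delta D :: 'k tpoly set set) \<subseteq> T ` D" using verts by (rule Union_least)
  then have "finite (\<Union>(Delta D :: 'k tpoly set set))" using fin by (rule finite_subset[OF _ finite_imageI])
  moreover have "T ` hook D \<in> (Delta D :: 'k tpoly set set)"
    unfolding Delta_eq[OF D] using clash_free_hook[OF D(1)] by simp
  ultimately have sc: "simplicial_complex (Delta D :: 'k tpoly set set)"
    unfolding simplicial_complex_def by auto
  have "card F = card (hook D)" if F: "F \<in> facets (Delta D :: 'k tpoly set set)" for F
  proof -
    obtain A where A: "clash_free D A" "F = T ` A"
      using F unfolding facets_def Delta_eq[OF D] by blast
    have "A = B" if "clash_free D B" "A \<subseteq> B" for B
    proof -
      have "T ` B \<in> (Delta D :: 'k tpoly set set)" unfolding Delta_eq[OF D] using that by simp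
      moreover have "F \<subseteq> T ` B" using that A by auto
      ultimately have "?T ` A = T ` B" using F A unfolding facets_def by simp
      then show ?thesis using inj by (simp add: inj_image_eq_iff)
    qed
    then have "card A = card (hook D)" by (rule card_maximal_clash_free[OF D A(1)])
    then show ?thesis unfolding A(2) using inj card_image inj_on_subset by (metis subset_UNIV)
  qed
  then show ?thesis using sc unfolding pure_of_size_def by simp
qed

text \<open>The alternative in the criterion is whether some later point that is compatible with \<open>S\<close>
  clashes with \<open>v\<close>.\<close>

lemma vertex_decomposable_Delta:
  assumes D: "ferrers_diagram D" "projection_property D"
  shows "vertex_decomposable (Delta D :: 'k::comm_ring_1 tpoly set set)"
proof (rule vertex_decomposable_by_order[OF pure_Delta[OF D]])
  let ?T = "T :: point \<Rightarrow> 'k tpoly"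
  let ?l = "sorted_list_of_set D"
  have inj: "inj ?T" by (simp add: inj_on_def)
  have fin: "finite D" using D unfolding ferrers_diagram_def by simp
  have mem: "T ` A \<in> (Delta D :: 'k tpoly set set) \<longleftrightarrow> clash_free D A" for A
    unfolding Delta_eq[OF D] using inj by (auto simp: inj_image_eq_iff)
  show "distinct (map ?T ?l)" by (simp add: distinct_map inj_on_def)
  show "F \<subseteq> set (map ?T ?l)" if "F \<in> Delta D" for F
    using that fin unfolding Delta_def by simp
  fix us v ws S
  assume split: "map ?T ?l = us @ v # ws" and S: "S \<subseteq> set us" and vS: "insert v S \<in> Delta D"
  obtain us' v' ws' where l: "?l = us' @ v' # ws'" and maps: "us = map T us'" "v = T v'" "ws = map T ws'"
    using split by (auto simp: map_eq_append_conv map_eq_Cons_conv)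
  have "sorted_wrt (<) ?l" by (rule strict_sorted_list_of_set)
  then have order: "\<And>u. u \<in> set us' \<Longrightarrow> u < v'" "\<And>w. w \<in> set ws' \<Longrightarrow> v' < w"
    unfolding l by (simp_all add: sorted_wrt_append)
  have later: "w \<in> set ws'" if "w \<in> D" "v' < w" for w
  proof -
    have "w \<in> set ?l" using that fin by simp
    then show ?thesis using that order(1)[of w] unfolding l by auto
  qed
  have wsD: "set ws' \<subseteq> D"
  proof -
    have "set ws' \<subseteq> set ?l" unfolding l by auto
    then show ?thesis using fin by simp
  qed
  obtain S' where S': "S' \<subseteq> set us'" "S = T ` S'"
    using S unfolding maps(1) set_map by (auto simp: subset_image_iff)
  have vS': "clash_free D (insert v' S')"
    using vS mem[of "insert v' S'"] unfolding maps S' by simp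
  show "(\<forall>G \<subseteq> set ws. S \<union> G \<in> Delta D \<longrightarrow> insert v (S \<union> G) \<in> Delta D) \<or>
    (\<forall>G \<subseteq> set ws. insert v (S \<union> G) \<in> Delta D \<longrightarrow> (\<exists>w \<in> set ws - G. insert w (S \<union> G) \<in> Delta D))"
  proof (cases "\<exists>w0. v' < w0 \<and> clash_free D (insert w0 S') \<and> clash D v' w0")
    case False
    have "insert v (S \<union> G) \<in> Delta D" if G: "G \<subseteq> set ws" "S \<union> G \<in> Delta D" for G
    proof -
      obtain G' where G': "G' \<subseteq> set ws'" "G = T ` G'"
        using G(1) unfolding maps(3) set_map by (auto simp: subset_image_iff)
      have SG: "clash_free D (S' \<union> G')" using G(2) mem[of "S' \<union> G'"] unfolding S' G' by (simp add: image_Un)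
      have "clash_free D (insert v' (S' \<union> G'))"
      proof (rule clash_free_compatible_insert[OF vS' SG])
        show "G' \<subseteq> D" using G'(1) wsD by simp
        fix g assume g: "g \<in> G'"
        then show "v' < g" using G'(1) order(2) by blast
        moreover have "clash_free D (insert g S')" using SG by (rule clash_free_subset) (use g in auto)
        ultimately show "\<not> clash D v' g" using False by blast
      qed
      then show ?thesis using mem[of "insert v' (S' \<union> G')"] unfolding S' G' maps by (simp add: image_Un)
    qed
    then show ?thesis by simp
  next
    case True
    then obtain w0 where w0: "v' < w0" "clash_free D (insert w0 S')" "clash D v' w0" by blast
    have "\<exists>w \<in> set ws - G. insert w (S \<union> G) \<in> Delta D" if G: "G \<subseteq> set ws" "insert v (S \<union> G) \<in> Delta D" for G
    proof -
      obtain G' where G': "G' \<subseteq> set ws'" "G = T ` G'"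
        using G(1) unfolding maps(3) set_map by (auto simp: subset_image_iff)
      have SG: "clash_free D (insert v' (S' \<union> G'))"
        using G(2) mem[of "insert v' (S' \<union> G')"] unfolding S' G' maps by (simp add: image_Un)
      have "\<exists>w. v' < w \<and> w \<notin> G' \<and> w \<in> D \<and> clash_free D (insert w (S' \<union> G'))"
        by (rule lex_order_shedding[OF D(1) _ _ SG w0]) (use S'(1) G'(1) order in blast)+
      then obtain w where w: "v' < w" "w \<notin> G'" "w \<in> D" "clash_free D (insert w (S' \<union> G'))" by blast
      have "insert (T w) (S \<union> G) \<in> Delta D"
        using w(4) mem[of "insert w (S' \<union> G')"] unfolding S' G' by (simp add: image_Un)
      moreover have "T w \<in> set ws - G"
        using later[OF w(3,1)] w(2) unfolding maps G' by auto
      ultimately show ?thesis by (rule bexI)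
    qed
    then show ?thesis by simp
  qed
qed

theorem theorem4p1:
  fixes D :: "(nat \<times> nat \<times> nat) set"
  assumes "ferrers_diagram D"
    and "projection_property D"
  shows "pure_complex (Delta D :: 'k::field_char_0 tpoly set set) \<and>
    vertex_decomposable (Delta D :: 'k tpoly set set) \<and>
    complex_dim (Delta D :: 'k tpoly set set) = int (num_x D) + int (num_y D) + int (num_z D) - 3"
proof -
  have pure: "pure_of_size (card (hook D)) (Delta D :: 'k tpoly set set)"
    by (rule pure_Delta[OF assms])
  have "complex_dim (Delta D :: 'k tpoly set set) = int (num_x D) + int (num_y D) + int (num_z D) - 3"
    using pure_of_size_dim[OF pure] card_hook[OF assms(1)] by linarith
  then show ?thesis
    using pure_of_size_pure[OF pure] vertex_decomposable_Delta[OF assms, where 'k = 'k] by blast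
qed

end
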